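(* Let $\mu\in\mathbb{C}^2$, let $\Gamma\in\mathbb{C}^{2\times 2}$ be Hermitian positive definite, let $C\in\mathbb{C}^{2\times2}$ be complex symmetric, and suppose that $\overline{\Gamma}-C^*\Gamma^{-1}C$ is positive definite. Let $[Z_1\ Z_2]^\top\sim \mathbb{C}N_2(\mu,\Gamma,C)$. Then the random variable $Q=Z_2/Z_1$ has density, for $q\in\mathbb{C}$, $$f_Q(q)=\frac{e^{-\frac12\underline{\mu}^*\underline{\Sigma}^{-1}\underline{\mu}}}{\pi^2\sqrt{\det\Gamma\,\det P}}\int_0^{\pi}{}_1F_1\!\left(2;\tfrac12;\frac{B_\mu(\theta,q)^2}{A(\theta,q)}\right)\frac{1}{A(\theta,q)^2}\,d\theta ,$$ where, with $\mathbf{q}:=[1\ \ q]^\top\in\mathbb{C}^2$, $$A(\theta,q)=\mathbf{q}^*\overline{P^{-1}}\mathbf{q}-\Re\big(e^{2i\theta}\mathbf{q}^\top R^\top\overline{P^{-1}}\mathbf{q}\big),\qquad B_\mu(\theta,q)=\Re\big(e^{i\theta}(\mu^*-\mu^\top R^\top)\overline{P^{-1}}\mathbf{q}\big).$$ In the special case $C=0$ and $\mu=0$, writing $Q^\circ$ for $Q$, one has $$f_{Q^\circ}(q)=\frac{1}{\pi\det\Gamma}\,\frac{1}{(\mathbf{q}^*\Gamma^{-1}\mathbf{q})^2}.$$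
   Context: The density of a complex random vector $\mathbf{Z}=\mathbf{X}+i\mathbf{Y}\in\mathbb{C}^n$ is the density of $[\mathbf{X}^\top\ \mathbf{Y}^\top]^\top\in\mathbb{R}^{2n}$. For $z\in\mathbb{C}^n$ write $\underline{z}:=\begin{bmatrix}z\\ \overline{z}\end{bmatrix}\in\mathbb{C}^{2n}$. For $\mu\in\mathbb{C}^n$, $\Gamma\in\mathbb{C}^{n\times n}$ Hermitian positive definite and $C\in\mathbb{C}^{n\times n}$ complex symmetric with $\overline{\Gamma}-C^*\Gamma^{-1}C$ positive definite, $\mathbf{Z}\sim\mathbb{C}N_n(\mu,\Gamma,C)$ means that $\mathbf{Z}$ has density $f_{\mathbf{Z}}(z)=\pi^{-n}(\det\underline{\Sigma})^{-1/2}e^{-\frac12(\underline{z}-\underline{\mu})^*\underline{\Sigma}^{-1}(\underline{z}-\underline{\mu})}$, where $\underline{\Sigma}=\begin{bmatrix}\Gamma& C\\ \overline{C}&\overline{\Gamma}\end{bmatrix}$ is the augmented covariance matrix. Set $P:=\overline{\Gamma}-\overline{C}\Gamma^{-1}C$ and $R:=\overline{C}\Gamma^{-1}$. ${}_1F_1$ is the confluent hypergeometric function. $\overline{M}$ denotes entrywise conjugation and $M^*$ the conjugate transpose. *)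

theory Defs
  imports "HOL-Probability.Probability"
begin

definition cnj_vec :: "complex^'n \<Rightarrow> complex^'n" where
  "cnj_vec z = (\<chi> i. cnj (z $ i))"

definition cnj_mat :: "complex^'n^'m \<Rightarrow> complex^'n^'m" where
  "cnj_mat A = map_matrix cnj A"

definition conj_transpose :: "complex^'n^'m \<Rightarrow> complex^'m^'n" where
  "conj_transpose A = cnj_mat (transpose A)"

text \<open>The form \<open>x\<^sup>* A y\<close>; the library's \<open>scalar_product x y\<close> is the bilinear \<open>x\<^sup>T y\<close>,
  without conjugation.\<close>

definition sesq_form :: "complex^'n \<Rightarrow> complex^'n^'n \<Rightarrow> complex^'n \<Rightarrow> complex" where
  "sesq_form x A y = scalar_product (cnj_vec x) (A *v y)"

definition hermitian :: "complex^'n^'n \<Rightarrow> bool" where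
  "hermitian A \<longleftrightarrow> conj_transpose A = A"

text \<open>Positive definite matrices are Hermitian, so \<open>x\<^sup>* A x\<close> is real and \<open>Re\<close> below is only a coercion
  from \<open>complex\<close> to \<open>real\<close>.\<close>

definition pos_def :: "complex^'n^'n \<Rightarrow> bool" where
  "pos_def A \<longleftrightarrow> hermitian A \<and> (\<forall>x. x \<noteq> 0 \<longrightarrow> 0 < Re (sesq_form x A x))"

definition stack :: "'a^'m \<Rightarrow> 'a^'n \<Rightarrow> 'a^('m + 'n)" where
  "stack x y = (\<chi> i. case i of Inl j \<Rightarrow> x $ j | Inr k \<Rightarrow> y $ k)"

definition block_mat ::
  "'a^'n^'m \<Rightarrow> 'a^'q^'m \<Rightarrow> 'a^'n^'p \<Rightarrow> 'a^'q^'p \<Rightarrow> 'a^('n + 'q)^('m + 'p)" where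
  "block_mat A B C D =
     (\<chi> i. case i of Inl j \<Rightarrow> stack (A $ j) (B $ j) | Inr k \<Rightarrow> stack (C $ k) (D $ k))"

text \<open>The density of \<open>Z = X + i Y\<close> is that of the real vector \<open>(X, Y)\<close> with respect to
  Lebesgue measure on \<open>\<real>\<^sup>2\<^sup>n\<close>, viewed as a function on complex vectors.\<close>

definition re_im :: "complex^'n \<Rightarrow> real^('n + 'n)" where
  "re_im z = stack (\<chi> i. Re (z $ i)) (\<chi> i. Im (z $ i))"

definition of_re_im :: "real^('n + 'n) \<Rightarrow> complex^'n" where
  "of_re_im x = (\<chi> i. Complex (x $ Inl i) (x $ Inr i))"

definition has_complex_density ::
  "'a measure \<Rightarrow> ('a \<Rightarrow> complex^'n) \<Rightarrow> (complex^'n \<Rightarrow> real) \<Rightarrow> bool" where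
  "has_complex_density M Z f \<longleftrightarrow>
     (\<forall>z. 0 \<le> f z) \<and>
     distributed M lborel (\<lambda>\<omega>. re_im (Z \<omega>)) (\<lambda>x. ennreal (f (of_re_im x)))"

text \<open>A complex random variable is a complex random vector of dimension one.\<close>

definition has_complex_density1 ::
  "'a measure \<Rightarrow> ('a \<Rightarrow> complex) \<Rightarrow> (complex \<Rightarrow> real) \<Rightarrow> bool" where
  "has_complex_density1 M Q f \<longleftrightarrow>
     has_complex_density M (\<lambda>\<omega>. vec (Q \<omega>) :: complex^1) (\<lambda>z. f (z $ 1))"

definition aug_vec :: "complex^'n \<Rightarrow> complex^('n + 'n)" where
  "aug_vec z = stack z (cnj_vec z)"

definition aug_cov :: "complex^'n^'n \<Rightarrow> complex^'n^'n \<Rightarrow> complex^('n + 'n)^('n + 'n)" where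
  "aug_cov \<Gamma> C = block_mat \<Gamma> C (cnj_mat C) (cnj_mat \<Gamma>)"

text \<open>The augmented covariance matrix is Hermitian positive definite for admissible \<open>\<Gamma>\<close>, \<open>C\<close>; its
  determinant and the quadratic form are real, and \<open>Re\<close> is again only a coercion.\<close>

definition aug_quad :: "complex^'n^'n \<Rightarrow> complex^'n^'n \<Rightarrow> complex^'n \<Rightarrow> real" where
  "aug_quad \<Gamma> C z = Re (sesq_form (aug_vec z) (matrix_inv (aug_cov \<Gamma> C)) (aug_vec z))"

definition complex_normal_density ::
  "complex^'n \<Rightarrow> complex^'n^'n \<Rightarrow> complex^'n^'n \<Rightarrow> complex^'n \<Rightarrow> real" where
  "complex_normal_density \<mu> \<Gamma> C z =
     1 / pi ^ CARD('n) * Re (det (aug_cov \<Gamma> C)) powr (-1/2) * exp (- (1/2) *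
       Re (sesq_form (aug_vec z - aug_vec \<mu>) (matrix_inv (aug_cov \<Gamma> C)) (aug_vec z - aug_vec \<mu>)))"

definition complex_normal ::
  "'a measure \<Rightarrow> ('a \<Rightarrow> complex^'n) \<Rightarrow> complex^'n \<Rightarrow> complex^'n^'n \<Rightarrow> complex^'n^'n \<Rightarrow> bool" where
  "complex_normal M Z \<mu> \<Gamma> C \<longleftrightarrow> has_complex_density M Z (complex_normal_density \<mu> \<Gamma> C)"

definition P_mat :: "complex^'n^'n \<Rightarrow> complex^'n^'n \<Rightarrow> complex^'n^'n" where
  "P_mat \<Gamma> C = cnj_mat \<Gamma> - cnj_mat C ** matrix_inv \<Gamma> ** C"

definition R_mat :: "complex^'n^'n \<Rightarrow> complex^'n^'n \<Rightarrow> complex^'n^'n" where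
  "R_mat \<Gamma> C = cnj_mat C ** matrix_inv \<Gamma>"

definition hypergeom_1F1 :: "real \<Rightarrow> real \<Rightarrow> real \<Rightarrow> real" where
  "hypergeom_1F1 a b x = (\<Sum>k. pochhammer a k / pochhammer b k * x ^ k / fact k)"

definition qvec :: "complex \<Rightarrow> complex^2" where
  "qvec q = vector [1, q]"

text \<open>The first term of \<open>A\<close> is real because \<open>P\<close> is Hermitian.\<close>

definition A_fun :: "complex^2^2 \<Rightarrow> complex^2^2 \<Rightarrow> real \<Rightarrow> complex \<Rightarrow> real" where
  "A_fun \<Gamma> C \<theta> q =
     Re (sesq_form (qvec q) (cnj_mat (matrix_inv (P_mat \<Gamma> C))) (qvec q))
     - Re (exp (2 * \<i> * of_real \<theta>) *
         scalar_product (qvec q)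
           ((transpose (R_mat \<Gamma> C) ** cnj_mat (matrix_inv (P_mat \<Gamma> C))) *v qvec q))"

definition B_fun :: "complex^2 \<Rightarrow> complex^2^2 \<Rightarrow> complex^2^2 \<Rightarrow> real \<Rightarrow> complex \<Rightarrow> real" where
  "B_fun \<mu> \<Gamma> C \<theta> q =
     Re (exp (\<i> * of_real \<theta>) *
       scalar_product (cnj_vec \<mu> - \<mu> v* transpose (R_mat \<Gamma> C))
         (cnj_mat (matrix_inv (P_mat \<Gamma> C)) *v qvec q))"

definition ratio_density :: "complex^2 \<Rightarrow> complex^2^2 \<Rightarrow> complex^2^2 \<Rightarrow> complex \<Rightarrow> real" where
  "ratio_density \<mu> \<Gamma> C q =
     exp (- (1/2) * aug_quad \<Gamma> C \<mu>) / (pi\<^sup>2 * sqrt (Re (det \<Gamma>) * Re (det (P_mat \<Gamma> C)))) *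
     integral {0..pi} (\<lambda>\<theta>.
       hypergeom_1F1 2 (1/2) ((B_fun \<mu> \<Gamma> C \<theta> q)\<^sup>2 / A_fun \<Gamma> C \<theta> q) * (1 / (A_fun \<Gamma> C \<theta> q)\<^sup>2))"

definition ratio_density_circ :: "complex^2^2 \<Rightarrow> complex \<Rightarrow> real" where
  "ratio_density_circ \<Gamma> q =
     1 / (pi * Re (det \<Gamma>)) * (1 / (Re (sesq_form (qvec q) (matrix_inv \<Gamma>) (qvec q)))\<^sup>2)"

end

theory Submission
  imports Defs
begin

text \<open>With \<open>N = P\<^sup>-\<^sup>1\<close>, the inverse of the augmented covariance matrix has the blocks
  \<open>N\<close> and \<open>R\<^sup>T cnj N\<close> up to sign and conjugation, so along the ray \<open>r e\<^sup>i\<^sup>\<theta> (1, q)\<close> the exponent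
  of the normal density is \<open>- A(\<theta>, q) r\<^sup>2 + 2 B(\<theta>, q) r\<close> up to a constant. Substituting \<open>z\<^sub>2 = q z\<^sub>1\<close>
  gives the density of \<open>Q\<close> as the integral of \<open>|z\<^sub>1|\<^sup>2\<close> times the normal density at \<open>z\<^sub>1 (1, q)\<close>;
  in polar coordinates for \<open>z\<^sub>1\<close> with \<open>\<theta>\<close> in \<open>(0, \<pi>)\<close> and \<open>r\<close> ranging over all of \<open>\<real>\<close>, only the even
  part \<open>cosh (2 B r)\<close> of \<open>exp (2 B r)\<close> contributes to the radial integral, and integrating its
  series against the odd Gaussian moments yields \<open>1F1 (2; 1/2; B\<^sup>2/A) / A\<^sup>2\<close>.\<close>

section \<open>Lebesgue measure on the complex plane\<close>

lemma borel_measurable_linear: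
  fixes f :: "'a::euclidean_space \<Rightarrow> 'b::euclidean_space"
  shows "linear f \<Longrightarrow> f \<in> borel_measurable borel"
  by (intro borel_measurable_continuous_onI linear_continuous_on linear_conv_bounded_linear[THEN iffD1])

text \<open>A linear map that merely renames the coordinate axes pulls a box back to a box with the
  same side lengths, and agreement on boxes determines Lebesgue measure. It carries
  \<open>lborel\<close> between the various real coordinatisations of complex vectors.\<close>

lemma distr_lborel_Basis:
  fixes f :: "'a::euclidean_space \<Rightarrow> 'b::euclidean_space"
  assumes "linear f" and "bij_betw f Basis Basis"
  shows "distr lborel lborel f = lborel"
proof -
  have inner_f: "f x \<bullet> f b = x \<bullet> b" if b: "b \<in> Basis" for x b
  proof -
    have "f x = f (\<Sum>c\<in>Basis. (x \<bullet> c) *\<^sub>R c)"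
      by (simp add: euclidean_representation)
    also have "\<dots> = (\<Sum>c\<in>Basis. (x \<bullet> c) *\<^sub>R f c)"
      using assms(1) by (simp add: linear_sum linear_scale)
    finally have "f x \<bullet> f b = (\<Sum>c\<in>Basis. (x \<bullet> c) * (f c \<bullet> f b))"
      by (simp add: inner_sum_left)
    also have "\<dots> = (\<Sum>c\<in>Basis. (x \<bullet> c) * (if c = b then 1 else 0))"
    proof (rule sum.cong[OF refl])
      fix c :: 'a assume "c \<in> Basis"
      with b have "f c \<in> Basis" "f b \<in> Basis" "f c = f b \<longleftrightarrow> c = b"
        using assms(2) by (auto simp: bij_betw_def inj_on_def)
      then have "f c \<bullet> f b = (if c = b then 1 else 0)"
        by (simp add: inner_Basis)
      then show "(x \<bullet> c) * (f c \<bullet> f b) = (x \<bullet> c) * (if c = b then 1 else 0)" by simp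
    qed
    finally show ?thesis
      using b by (simp add: if_distrib cong: if_cong)
  qed
  have [measurable]: "f \<in> borel_measurable borel"
    using assms(1) by (rule borel_measurable_linear)
  have Basis_image: "Basis = f ` Basis"
    using assms(2) by (simp add: bij_betw_def)
  have "lborel = distr lborel borel f"
  proof (rule lborel_eqI)
    fix l u :: 'b assume lu: "\<And>b. b \<in> Basis \<Longrightarrow> l \<bullet> b \<le> u \<bullet> b"
    \<comment> \<open>Corners of the preimage box: the coordinate of \<open>l'\<close> along
      \<open>b\<close> is that of \<open>l\<close> along \<open>f b\<close>.\<close>
    define l' where "l' = (\<Sum>b\<in>Basis. (l \<bullet> f b) *\<^sub>R b)"
    define u' where "u' = (\<Sum>b\<in>Basis. (u \<bullet> f b) *\<^sub>R b)"
    have l': "l' \<bullet> b = l \<bullet> f b" and u': "u' \<bullet> b = u \<bullet> f b" if "b \<in> Basis" for b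
      using that by (simp_all add: l'_def u'_def)
    have fB: "f b \<in> Basis" if "b \<in> Basis" for b using that Basis_image by blast
    have "f -` box l u = box l' u'"
    proof -
      have "x \<in> f -` box l u \<longleftrightarrow> (\<forall>b\<in>f ` Basis. l \<bullet> b < f x \<bullet> b \<and> f x \<bullet> b < u \<bullet> b)" for x
        unfolding Basis_image[symmetric] by (auto simp: box_def)
      then show ?thesis by (auto simp: box_def inner_f l' u')
    qed
    then have "emeasure (distr lborel borel f) (box l u) = emeasure lborel (box l' u')"
      by (subst emeasure_distr) (auto simp: space_borel)
    also have "\<dots> = (\<Prod>b\<in>Basis. (u' - l') \<bullet> b)"
      using lu fB by (intro emeasure_lborel_box) (simp add: l' u')
    also have "\<dots> = (\<Prod>b\<in>Basis. (u - l) \<bullet> f b)"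
      by (intro arg_cong[where f=ennreal] prod.cong) (auto simp: inner_diff_left l' u')
    also have "\<dots> = (\<Prod>b\<in>Basis. (u - l) \<bullet> b)"
      by (intro arg_cong[where f=ennreal] prod.reindex_bij_betw[OF assms(2)])
    finally show "emeasure (distr lborel borel f) (box l u) = (\<Prod>b\<in>Basis. (u - l) \<bullet> b)" .
  qed simp
  \<comment> \<open>\<open>distr\<close> sees only the space and the sigma-algebra of its target,
    which \<open>borel\<close> and \<open>lborel\<close> share.\<close>
  then show ?thesis by (simp add: distr_def)
qed

lemma nn_integral_lborel_complex:
  assumes [measurable]: "f \<in> borel_measurable borel"
  shows "(\<integral>\<^sup>+z. f z \<partial>lborel) = (\<integral>\<^sup>+x. \<integral>\<^sup>+y. f (Complex x y) \<partial>lborel \<partial>lborel)"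
proof -
  let ?g = "\<lambda>p. Complex (fst p) (snd p)"
  have lin: "linear ?g"
    by (rule linearI) (simp_all add: complex_eq_iff)
  have [measurable]: "?g \<in> borel_measurable borel"
    using lin by (rule borel_measurable_linear)
  have "bij_betw ?g Basis Basis"
    by (auto simp: bij_betw_def Basis_prod_def Basis_complex_def inj_on_def complex_eq_iff)
  then have "(\<integral>\<^sup>+z. f z \<partial>lborel) = (\<integral>\<^sup>+z. f z \<partial>distr lborel lborel ?g)"
    using lin by (simp only: distr_lborel_Basis)
  also have "\<dots> = (\<integral>\<^sup>+p. f (?g p) \<partial>lborel)"
    by (subst nn_integral_distr) auto
  also have "\<dots> = (\<integral>\<^sup>+p. f (?g p) \<partial>(lborel \<Otimes>\<^sub>M lborel))"
    by (simp only: lborel_prod)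
  also have "\<dots> = (\<integral>\<^sup>+x. \<integral>\<^sup>+y. f (Complex x y) \<partial>lborel \<partial>lborel)"
    by (subst lborel.nn_integral_fst[symmetric]) (simp_all add: lborel_prod)
  finally show ?thesis .
qed

lemma measurable_Complex [measurable]:
  assumes "f \<in> borel_measurable M" "g \<in> borel_measurable M"
  shows "(\<lambda>x. Complex (f x) (g x)) \<in> borel_measurable M"
  using assms by (simp add: borel_measurable_complex_iff)

lemma nn_integral_lborel_complex':
  assumes [measurable]: "f \<in> borel_measurable borel"
  shows "(\<integral>\<^sup>+z. f z \<partial>lborel) = (\<integral>\<^sup>+y. \<integral>\<^sup>+x. f (Complex x y) \<partial>lborel \<partial>lborel)"
  unfolding nn_integral_lborel_complex[OF assms]
  by (rule lborel_pair.Fubini'[symmetric]) simp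

text \<open>Multiplication by \<open>w\<close> is a composition of two shears and scalings of the coordinate axes,
  one of which divides by \<open>Re w\<close>.\<close>

lemma nn_integral_lborel_complex_mult:
  assumes [measurable]: "f \<in> borel_measurable borel" and "Re w \<noteq> 0"
  shows "(\<integral>\<^sup>+z. f z \<partial>lborel) = ennreal ((cmod w)\<^sup>2) * (\<integral>\<^sup>+z. f (w * z) \<partial>lborel)"
proof -
  define a where "a = Re w"
  define b where "b = Im w"
  define n where "n = (cmod w)\<^sup>2"
  have a: "a \<noteq> 0" using assms(2) by (simp add: a_def)
  have n: "n = a\<^sup>2 + b\<^sup>2" by (simp add: n_def a_def b_def cmod_power2)
  have n0: "n > 0" using a by (simp add: n add_pos_nonneg)
  have mult: "w * Complex x y = Complex (a * x - b * y) (b * x + a * y)" for x y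
    by (simp add: complex_eq_iff a_def b_def)
  \<comment> \<open>Here \<open>x\<close> is already the real part of the product while
    \<open>y\<close> is still the imaginary part of the argument. The Jacobian \<open>n\<close> thus
    splits into \<open>a\<close> (replacing the first coordinate at fixed \<open>y\<close>) and
    \<open>n / a\<close> (replacing the second at fixed \<open>x\<close>).\<close>
  define F where "F = (\<lambda>x y. f (Complex x ((b / a) * x + (n / a) * y)))"
  have [measurable]: "(\<lambda>(x, y). F x y) \<in> borel_measurable (borel \<Otimes>\<^sub>M borel)"
    unfolding F_def by measurable
  have 1: "ennreal \<bar>a\<bar> * (\<integral>\<^sup>+x. f (w * Complex x y) \<partial>lborel) = (\<integral>\<^sup>+x. F x y \<partial>lborel)" for y
  proof -
    have "f (w * Complex x y) = F (- b * y + a * x) y" for x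
    proof -
      have "b * x + a * y = (b / a) * (- b * y + a * x) + (n / a) * y"
        using a by (simp add: n field_simps power2_eq_square)
      moreover have "a * x - b * y = - b * y + a * x" by simp
      ultimately show ?thesis by (simp only: mult F_def)
    qed
    then show ?thesis
      using nn_integral_real_affine[OF _ a, of "\<lambda>x. F x y" "- b * y"] by (simp add: F_def)
  qed
  have 2: "ennreal \<bar>n / a\<bar> * (\<integral>\<^sup>+y. F x y \<partial>lborel) = (\<integral>\<^sup>+y. f (Complex x y) \<partial>lborel)" for x
    using nn_integral_real_affine[of "\<lambda>y. f (Complex x y)" "n / a" "(b / a) * x"] a n0
    by (simp add: F_def)
  have "ennreal n * (\<integral>\<^sup>+z. f (w * z) \<partial>lborel) = ennreal \<bar>n / a\<bar> * (ennreal \<bar>a\<bar> * (\<integral>\<^sup>+z. f (w * z) \<partial>lborel))"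
    using a n0 by (simp add: ennreal_mult[symmetric] mult.assoc[symmetric] abs_mult[symmetric])
  also have "ennreal \<bar>a\<bar> * (\<integral>\<^sup>+z. f (w * z) \<partial>lborel) = (\<integral>\<^sup>+y. \<integral>\<^sup>+x. F x y \<partial>lborel \<partial>lborel)"
    by (simp add: nn_integral_lborel_complex' nn_integral_cmult[symmetric] 1)
  also have "\<dots> = (\<integral>\<^sup>+x. \<integral>\<^sup>+y. F x y \<partial>lborel \<partial>lborel)"
    by (rule lborel_pair.Fubini') simp
  also have "ennreal \<bar>n / a\<bar> * \<dots> = (\<integral>\<^sup>+x. \<integral>\<^sup>+y. f (Complex x y) \<partial>lborel \<partial>lborel)"
    by (simp add: nn_integral_cmult[symmetric] 2 del: abs_divide)
  also have "\<dots> = (\<integral>\<^sup>+z. f z \<partial>lborel)"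
    by (simp add: nn_integral_lborel_complex)
  finally show ?thesis by (simp add: n_def)
qed

section \<open>Polar coordinates with a signed radius\<close>

text \<open>The function \<open>- cot\<close> increases from minus to plus infinity on
  \<open>(0, pi)\<close> with derivative \<open>1 / (sin \<theta>)\<^sup>2\<close>. Writing this
  substitution as an equation for \<open>lborel\<close> allows it to be rewritten directly inside an
  integral.\<close>

lemma lborel_eq_distr_cot:
  "lborel = distr (density lborel (\<lambda>\<theta>. ennreal (1 / (sin \<theta>)\<^sup>2) * indicator {0<..<pi} \<theta>)) borel
     (\<lambda>\<theta>. - (cos \<theta> / sin \<theta>))" (is "_ = distr (density _ ?d) _ ?g")
proof (rule lborel_eqI)
  fix l u :: real assume "\<And>b. b \<in> Basis \<Longrightarrow> l \<bullet> b \<le> u \<bullet> b"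
  then have lu: "l \<le> u" by simp
  \<comment> \<open>The inverse of \<open>- cot\<close> on \<open>(0, pi)\<close>, because
    \<open>- cot \<theta> = tan (\<theta> - pi / 2)\<close>.\<close>
  define \<alpha> where "\<alpha> = (\<lambda>t. arctan t + pi / 2)"
  have g: "?g \<theta> = tan (\<theta> - pi / 2)" for \<theta>
    by (simp add: tan_def sin_diff cos_diff)
  have \<alpha>: "0 < \<alpha> t" "\<alpha> t < pi" for t
    using arctan_bounded[of t] by (auto simp: \<alpha>_def)
  have \<alpha>le: "\<alpha> l \<le> \<alpha> u" using lu by (simp add: \<alpha>_def arctan_le_iff)
  have mem: "l < ?g \<theta> \<and> ?g \<theta> < u \<longleftrightarrow> \<alpha> l < \<theta> \<and> \<theta> < \<alpha> u" if "0 < \<theta>" "\<theta> < pi" for \<theta>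
  proof -
    have "\<theta> - pi / 2 = arctan (tan (\<theta> - pi / 2))"
      using that by (simp add: arctan_tan)
    then have "\<alpha> l < \<theta> \<and> \<theta> < \<alpha> u \<longleftrightarrow> arctan l < arctan (tan (\<theta> - pi / 2)) \<and> arctan (tan (\<theta> - pi / 2)) < arctan u"
      unfolding \<alpha>_def by linarith
    then show ?thesis by (simp only: g arctan_less_iff)
  qed
  have "?g -` {l<..<u} \<in> sets borel"
    using measurable_sets[of ?g borel borel "{l<..<u}"] by simp
  then have "emeasure (distr (density lborel ?d) borel ?g) (box l u)
      = (\<integral>\<^sup>+\<theta>. ?d \<theta> * indicator (?g -` {l<..<u}) \<theta> \<partial>lborel)"
    by (subst emeasure_distr) (simp_all add: emeasure_density box_real)
  also have "\<dots> = (\<integral>\<^sup>+\<theta>. ennreal (1 / (sin \<theta>)\<^sup>2) * indicator {\<alpha> l .. \<alpha> u} \<theta> \<partial>lborel)"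
  proof (rule nn_integral_cong_AE)
    \<comment> \<open>The preimage is an open interval; adding its two end points, a null set, gives
      the closed interval to which the fundamental theorem applies.\<close>
    show "AE \<theta> in lborel. ?d \<theta> * indicator (?g -` {l<..<u}) \<theta>
        = ennreal (1 / (sin \<theta>)\<^sup>2) * indicator {\<alpha> l .. \<alpha> u} \<theta>"
      using AE_lborel_singleton[of "\<alpha> l"] AE_lborel_singleton[of "\<alpha> u"]
    proof eventually_elim
      case (elim \<theta>)
      show ?case
      proof (cases "0 < \<theta> \<and> \<theta> < pi")
        case True
        then show ?thesis using mem[of \<theta>] elim by (auto simp: indicator_def)
      next
        case False
        then show ?thesis using \<alpha>[of l] \<alpha>[of u] by (auto simp: indicator_def)
      qed
    qed
  qed
  also have "\<dots> = ennreal (tan (\<alpha> u - pi / 2) - tan (\<alpha> l - pi / 2))"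
  proof (rule nn_integral_FTC_Icc)
    fix \<theta> assume "\<theta> \<in> {\<alpha> l .. \<alpha> u}"
    then have "0 < \<theta>" "\<theta> < pi" using \<alpha>[of l] \<alpha>[of u] by auto
    then have sin: "sin \<theta> > 0" by (intro sin_gt_zero)
    have cos: "cos (\<theta> - pi / 2) = sin \<theta>" by (simp add: cos_diff)
    have "((\<lambda>\<theta>. \<theta> - pi / 2) has_real_derivative 1) (at \<theta>)"
      by (auto intro!: derivative_eq_intros)
    moreover have "(tan has_real_derivative inverse ((cos (\<theta> - pi / 2))\<^sup>2)) (at (\<theta> - pi / 2))"
      using sin by (intro DERIV_tan) (simp add: cos)
    ultimately have "((\<lambda>\<theta>. tan (\<theta> - pi / 2)) has_real_derivative inverse ((cos (\<theta> - pi / 2))\<^sup>2) * 1) (at \<theta>)"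
      by (rule DERIV_chain2[rotated])
    then show "((\<lambda>\<theta>. tan (\<theta> - pi / 2)) has_real_derivative 1 / (sin \<theta>)\<^sup>2) (at \<theta>)"
      by (simp add: cos inverse_eq_divide)
  qed (use \<alpha>le in simp_all)
  also have "\<dots> = ennreal (u - l)"
    by (simp add: \<alpha>_def tan_arctan)
  finally show "emeasure (distr (density lborel ?d) borel ?g) (box l u) = (\<Prod>b\<in>Basis. (u - l) \<bullet> b)"
    by simp
qed simp

lemma measurable_rcis [measurable]:
  assumes [measurable]: "f \<in> borel_measurable M" "g \<in> borel_measurable M"
  shows "(\<lambda>x. rcis (f x) (g x)) \<in> borel_measurable M"
  by (simp add: borel_measurable_complex_iff)

text \<open>Writing \<open>x = - y s\<close> and then \<open>s = - cot \<theta>\<close> makes \<open>r\<close> range over all of \<open>\<real>\<close> and \<open>\<theta>\<close> over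
  a half circle.\<close>

lemma nn_integral_lborel_complex_polar:
  assumes [measurable]: "f \<in> borel_measurable borel"
  shows "(\<integral>\<^sup>+z. f z \<partial>lborel) =
    (\<integral>\<^sup>+\<theta>. indicator {0<..<pi} \<theta> * (\<integral>\<^sup>+r. ennreal \<bar>r\<bar> * f (rcis r \<theta>) \<partial>lborel) \<partial>lborel)"
proof -
  have "(\<integral>\<^sup>+z. f z \<partial>lborel) = (\<integral>\<^sup>+y. \<integral>\<^sup>+x. f (Complex x y) \<partial>lborel \<partial>lborel)"
    by (rule nn_integral_lborel_complex') fact
  also have "\<dots> = (\<integral>\<^sup>+y. \<integral>\<^sup>+s. ennreal \<bar>y\<bar> * f (Complex (- y * s) y) \<partial>lborel \<partial>lborel)"
  proof (rule nn_integral_cong_AE)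
    \<comment> \<open>The substitution \<open>x = - y * s\<close> degenerates only for
      \<open>y = 0\<close>, a null set.\<close>
    show "AE y in lborel. (\<integral>\<^sup>+x. f (Complex x y) \<partial>lborel)
        = (\<integral>\<^sup>+s. ennreal \<bar>y\<bar> * f (Complex (- y * s) y) \<partial>lborel)"
      using AE_lborel_singleton[of 0]
    proof eventually_elim
      case (elim y)
      then show ?case
        using nn_integral_real_affine[of "\<lambda>x. f (Complex x y)" "- y" 0]
        by (simp add: nn_integral_cmult)
    qed
  qed
  also have "\<dots> = (\<integral>\<^sup>+s. \<integral>\<^sup>+y. ennreal \<bar>y\<bar> * f (Complex (- y * s) y) \<partial>lborel \<partial>lborel)"
    by (rule lborel_pair.Fubini') simp
  also have "\<dots> = (\<integral>\<^sup>+\<theta>. ennreal (1 / (sin \<theta>)\<^sup>2) * indicator {0<..<pi} \<theta> *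
      (\<integral>\<^sup>+y. ennreal \<bar>y\<bar> * f (Complex (- y * - (cos \<theta> / sin \<theta>)) y) \<partial>lborel) \<partial>lborel)"
    by (subst lborel_eq_distr_cot, subst nn_integral_distr, simp, simp, subst nn_integral_density) simp_all
  also have "\<dots> = (\<integral>\<^sup>+\<theta>. indicator {0<..<pi} \<theta> * (\<integral>\<^sup>+r. ennreal \<bar>r\<bar> * f (rcis r \<theta>) \<partial>lborel) \<partial>lborel)"
  proof (rule nn_integral_cong)
    fix \<theta> :: real
    show "ennreal (1 / (sin \<theta>)\<^sup>2) * indicator {0<..<pi} \<theta> *
        (\<integral>\<^sup>+y. ennreal \<bar>y\<bar> * f (Complex (- y * - (cos \<theta> / sin \<theta>)) y) \<partial>lborel)
      = indicator {0<..<pi} \<theta> * (\<integral>\<^sup>+r. ennreal \<bar>r\<bar> * f (rcis r \<theta>) \<partial>lborel)"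
    proof (cases "0 < \<theta> \<and> \<theta> < pi")
      case True
      then have s: "sin \<theta> > 0" by (simp add: sin_gt_zero)
      let ?I = "\<integral>\<^sup>+r. ennreal \<bar>r\<bar> * f (rcis r \<theta>) \<partial>lborel"
      \<comment> \<open>Setting \<open>y = sin \<theta> * r\<close> turns the point into
        \<open>rcis r \<theta>\<close>. One factor \<open>sin \<theta>\<close> comes from the
        Jacobian and one from \<open>\<bar>y\<bar>\<close>; together they cancel the density
        \<open>1 / (sin \<theta>)\<^sup>2\<close>.\<close>
      have "(\<integral>\<^sup>+y. ennreal \<bar>y\<bar> * f (Complex (- y * - (cos \<theta> / sin \<theta>)) y) \<partial>lborel)
          = ennreal (sin \<theta>) * (\<integral>\<^sup>+r. ennreal \<bar>sin \<theta> * r\<bar> * f (Complex (sin \<theta> * r * (cos \<theta> / sin \<theta>)) (sin \<theta> * r)) \<partial>lborel)"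
        using s by (subst nn_integral_real_affine[where c = "sin \<theta>" and t = 0]) simp_all
      also have "(\<lambda>r. ennreal \<bar>sin \<theta> * r\<bar> * f (Complex (sin \<theta> * r * (cos \<theta> / sin \<theta>)) (sin \<theta> * r)))
          = (\<lambda>r. ennreal (sin \<theta>) * (ennreal \<bar>r\<bar> * f (rcis r \<theta>)))"
      proof
        fix r
        have "Complex (sin \<theta> * r * (cos \<theta> / sin \<theta>)) (sin \<theta> * r) = rcis r \<theta>"
          using s by (simp add: complex_eq_iff)
        moreover have "ennreal \<bar>sin \<theta> * r\<bar> = ennreal (sin \<theta>) * ennreal \<bar>r\<bar>"
          using s by (simp add: abs_mult ennreal_mult)
        ultimately show "ennreal \<bar>sin \<theta> * r\<bar> * f (Complex (sin \<theta> * r * (cos \<theta> / sin \<theta>)) (sin \<theta> * r))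
            = ennreal (sin \<theta>) * (ennreal \<bar>r\<bar> * f (rcis r \<theta>))"
          by (simp only: mult.assoc)
      qed
      also have "(\<integral>\<^sup>+r. ennreal (sin \<theta>) * (ennreal \<bar>r\<bar> * f (rcis r \<theta>)) \<partial>lborel) = ennreal (sin \<theta>) * ?I"
        by (rule nn_integral_cmult) simp
      finally have eq: "(\<integral>\<^sup>+y. ennreal \<bar>y\<bar> * f (Complex (- y * - (cos \<theta> / sin \<theta>)) y) \<partial>lborel)
          = ennreal ((sin \<theta>)\<^sup>2) * ?I"
        using s by (simp add: ennreal_mult power2_eq_square mult.assoc)
      have "ennreal (1 / (sin \<theta>)\<^sup>2) * ennreal ((sin \<theta>)\<^sup>2) = 1"
        using s by (simp add: ennreal_mult[symmetric])
      then show ?thesis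
        using True unfolding eq by (simp add: mult.assoc[symmetric])
    qed (auto simp: indicator_def)
  qed
  finally show ?thesis .
qed

text \<open>By Tonelli, since the sections of the imaginary axis are empty except at
  \<open>x = 0\<close>. It supplies the condition on \<open>w\<close> in
  \<open>nn_integral_lborel_complex_mult\<close>.\<close>

lemma AE_lborel_Re_nonzero: "AE w in lborel. Re w \<noteq> 0"
proof -
  have [measurable]: "{w. Re w = 0} \<in> sets borel"
    by (intro borel_closed closed_Collect_eq continuous_intros)
  have "(\<integral>\<^sup>+w. indicator {w. Re w = 0} w \<partial>lborel)
      = (\<integral>\<^sup>+x. \<integral>\<^sup>+y. indicator {w. Re w = 0} (Complex x y) \<partial>lborel \<partial>lborel)"
    by (rule nn_integral_lborel_complex) simp
  also have "\<dots> = (\<integral>\<^sup>+x. 0 \<partial>(lborel :: real measure))"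
  proof (rule nn_integral_cong_AE)
    show "AE x in lborel. (\<integral>\<^sup>+y. indicator {w. Re w = 0} (Complex x y) \<partial>lborel) = 0"
      using AE_lborel_singleton[of 0] by eventually_elim (simp add: indicator_def)
  qed
  finally have "emeasure lborel {w. Re w = 0} = 0" by simp
  then have "AE w in lborel. w \<notin> {w. Re w = 0}"
    by (intro AE_not_in null_setsI) simp_all
  then show ?thesis by simp
qed

text \<open>Substitute \<open>z = w * q\<close> in the second coordinate, swap the order of
  integration and pass to polar coordinates in \<open>w\<close>. The weight
  \<open>\<bar>r\<bar> ^ 3\<close> is the Jacobian \<open>(cmod w)\<^sup>2\<close> times the polar
  factor \<open>\<bar>r\<bar>\<close>. Taking indicators for \<open>g\<close> identifies the law of
  the quotient.\<close>

lemma nn_integral_ratio: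
  fixes f :: "complex \<times> complex \<Rightarrow> ennreal" and g :: "complex \<Rightarrow> ennreal"
  assumes [measurable]: "f \<in> borel_measurable borel" "g \<in> borel_measurable borel"
  shows "(\<integral>\<^sup>+p. g (snd p / fst p) * f p \<partial>lborel) =
    (\<integral>\<^sup>+q. g q * (\<integral>\<^sup>+\<theta>. indicator {0<..<pi} \<theta> *
      (\<integral>\<^sup>+r. ennreal (\<bar>r\<bar> ^ 3) * f (rcis r \<theta>, rcis r \<theta> * q) \<partial>lborel) \<partial>lborel) \<partial>lborel)"
proof -
  have [measurable]: "f \<in> borel_measurable (borel \<Otimes>\<^sub>M borel)"
    by (simp add: borel_prod)
  have "(\<lambda>p. g (snd p / fst p) * f p) \<in> borel_measurable (borel \<Otimes>\<^sub>M borel)"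
    by measurable
  then have m: "(\<lambda>p. g (snd p / fst p) * f p) \<in> borel_measurable (lborel \<Otimes>\<^sub>M lborel)"
    by (simp only: measurable_cong_sets[OF sets_pair_measure_cong[OF sets_lborel sets_lborel] refl])
  have "(\<integral>\<^sup>+p. g (snd p / fst p) * f p \<partial>lborel) = (\<integral>\<^sup>+p. g (snd p / fst p) * f p \<partial>(lborel \<Otimes>\<^sub>M lborel))"
    by (simp only: lborel_prod)
  also have "\<dots> = (\<integral>\<^sup>+w. \<integral>\<^sup>+z. g (z / w) * f (w, z) \<partial>lborel \<partial>lborel)"
    using lborel.nn_integral_fst[OF m] by simp
  also have "\<dots> = (\<integral>\<^sup>+w. \<integral>\<^sup>+q. g q * (ennreal ((cmod w)\<^sup>2) * f (w, w * q)) \<partial>lborel \<partial>lborel)"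
  proof (rule nn_integral_cong_AE)
    \<comment> \<open>The excluded null set \<open>Re w = 0\<close> contains \<open>w = 0\<close>,
      where the quotient is 0 by convention.\<close>
    show "AE w in lborel. (\<integral>\<^sup>+z. g (z / w) * f (w, z) \<partial>lborel)
        = (\<integral>\<^sup>+q. g q * (ennreal ((cmod w)\<^sup>2) * f (w, w * q)) \<partial>lborel)"
      using AE_lborel_Re_nonzero
    proof eventually_elim
      case (elim w)
      then have "w \<noteq> 0" by auto
      have "(\<integral>\<^sup>+z. g (z / w) * f (w, z) \<partial>lborel)
          = ennreal ((cmod w)\<^sup>2) * (\<integral>\<^sup>+q. g (w * q / w) * f (w, w * q) \<partial>lborel)"
        using elim by (intro nn_integral_lborel_complex_mult) simp_all
      also have "\<dots> = (\<integral>\<^sup>+q. ennreal ((cmod w)\<^sup>2) * (g (w * q / w) * f (w, w * q)) \<partial>lborel)"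
        by (rule nn_integral_cmult[symmetric]) simp
      also have "\<dots> = (\<integral>\<^sup>+q. g q * (ennreal ((cmod w)\<^sup>2) * f (w, w * q)) \<partial>lborel)"
        using \<open>w \<noteq> 0\<close> by (intro nn_integral_cong) (simp add: mult.left_commute)
      finally show ?case .
    qed
  qed
  also have "\<dots> = (\<integral>\<^sup>+q. \<integral>\<^sup>+w. g q * (ennreal ((cmod w)\<^sup>2) * f (w, w * q)) \<partial>lborel \<partial>lborel)"
    by (rule lborel_pair.Fubini'[symmetric]) simp
  also have "\<dots> = (\<integral>\<^sup>+q. g q * (\<integral>\<^sup>+\<theta>. indicator {0<..<pi} \<theta> *
      (\<integral>\<^sup>+r. ennreal (\<bar>r\<bar> ^ 3) * f (rcis r \<theta>, rcis r \<theta> * q) \<partial>lborel) \<partial>lborel) \<partial>lborel)"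
  proof (rule nn_integral_cong)
    fix q
    have cube: "ennreal \<bar>r\<bar> * (ennreal ((cmod (rcis r \<theta>))\<^sup>2) * f (rcis r \<theta>, rcis r \<theta> * q))
        = ennreal (\<bar>r\<bar> ^ 3) * f (rcis r \<theta>, rcis r \<theta> * q)" for r \<theta>
    proof -
      have "ennreal \<bar>r\<bar> * ennreal ((cmod (rcis r \<theta>))\<^sup>2) = ennreal (\<bar>r\<bar> ^ 3)"
        by (simp only: complex_mod_rcis ennreal_mult[symmetric] abs_ge_zero zero_le_power)
           (simp add: power3_eq_cube power2_eq_square mult_ac)
      then show ?thesis by (simp only: mult.assoc[symmetric])
    qed
    have "(\<integral>\<^sup>+w. g q * (ennreal ((cmod w)\<^sup>2) * f (w, w * q)) \<partial>lborel)
        = g q * (\<integral>\<^sup>+w. ennreal ((cmod w)\<^sup>2) * f (w, w * q) \<partial>lborel)"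
      by (rule nn_integral_cmult) simp
    also have "(\<integral>\<^sup>+w. ennreal ((cmod w)\<^sup>2) * f (w, w * q) \<partial>lborel)
        = (\<integral>\<^sup>+\<theta>. indicator {0<..<pi} \<theta> *
            (\<integral>\<^sup>+r. ennreal \<bar>r\<bar> * (ennreal ((cmod (rcis r \<theta>))\<^sup>2) * f (rcis r \<theta>, rcis r \<theta> * q)) \<partial>lborel) \<partial>lborel)"
      by (rule nn_integral_lborel_complex_polar) simp
    finally show "(\<integral>\<^sup>+w. g q * (ennreal ((cmod w)\<^sup>2) * f (w, w * q)) \<partial>lborel)
        = g q * (\<integral>\<^sup>+\<theta>. indicator {0<..<pi} \<theta> *
            (\<integral>\<^sup>+r. ennreal (\<bar>r\<bar> ^ 3) * f (rcis r \<theta>, rcis r \<theta> * q) \<partial>lborel) \<partial>lborel)"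
      by (simp only: cube)
  qed
  finally show ?thesis .
qed

section \<open>A radial Gaussian integral\<close>

text \<open>Fold the negative half-line onto the positive one. The two half-lines overlap only in
  the null set \<open>{0}\<close>.\<close>

lemma nn_integral_even_part:
  fixes f :: "real \<Rightarrow> ennreal"
  assumes [measurable]: "f \<in> borel_measurable borel"
  shows "(\<integral>\<^sup>+x. f x \<partial>lborel) = (\<integral>\<^sup>+x. indicator {0..} x * (f x + f (- x)) \<partial>lborel)"
proof -
  have "(\<integral>\<^sup>+x. f x \<partial>lborel) = (\<integral>\<^sup>+x. indicator {0..} x * f x + indicator {..0} x * f x \<partial>lborel)"
    by (rule nn_integral_cong_AE, use AE_lborel_singleton[of 0] in eventually_elim)
       (auto simp: indicator_def)
  also have "\<dots> = (\<integral>\<^sup>+x. indicator {0..} x * f x \<partial>lborel) + (\<integral>\<^sup>+x. indicator {..0} x * f x \<partial>lborel)"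
    by (rule nn_integral_add) simp_all
  also have "(\<integral>\<^sup>+x. indicator {..0} x * f x \<partial>lborel) = (\<integral>\<^sup>+x. indicator {0..} x * f (- x) \<partial>lborel)"
    by (subst nn_integral_real_affine[where c = "-1" and t = 0])
       (auto simp: indicator_def intro!: nn_integral_cong)
  also have "(\<integral>\<^sup>+x. indicator {0..} x * f x \<partial>lborel) + \<dots>
      = (\<integral>\<^sup>+x. indicator {0..} x * (f x + f (- x)) \<partial>lborel)"
    by (subst nn_integral_add[symmetric]) (simp_all add: distrib_left)
  finally show ?thesis .
qed

text \<open>The moment for \<open>A = 1\<close> is rescaled by \<open>sqrt A\<close>: the
  differential contributes \<open>sqrt A\<close> and the power \<open>x ^ (2 * k + 1)\<close>
  contributes \<open>sqrt A * A ^ k\<close>, together \<open>A ^ (k + 1)\<close>.\<close>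

lemma nn_integral_gaussian_moment_odd:
  fixes A :: real assumes "A > 0"
  shows "(\<integral>\<^sup>+x. ennreal (indicator {0..} x * (exp (- A * x\<^sup>2) * x ^ (2 * k + 1))) \<partial>lborel)
    = ennreal (fact k / (2 * A ^ (k + 1)))" (is "?I = _")
proof -
  let ?f = "\<lambda>x::real. indicator {0..} x * (exp (- x\<^sup>2) * x ^ (2 * k + 1))"
  have "has_bochner_integral lborel ?f (fact k / 2)"
    using gaussian_moment_odd_pos[of k] by (simp only: real_scaleR_def)
  then have int: "integrable lborel ?f" "integral\<^sup>L lborel ?f = fact k / 2"
    by (simp_all only: has_bochner_integral_iff)
  have "AE x in lborel. 0 \<le> ?f x" by (rule AE_I2) (simp add: indicator_def)
  from nn_integral_eq_integral[OF int(1) this]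
  have "ennreal (fact k / 2) = (\<integral>\<^sup>+x. ennreal (?f x) \<partial>lborel)"
    by (simp only: int(2))
  also have "\<dots> = ennreal (sqrt A) * (\<integral>\<^sup>+x. ennreal (?f (sqrt A * x)) \<partial>lborel)"
    using assms by (subst nn_integral_real_affine[where c = "sqrt A" and t = 0]) simp_all
  also have "(\<lambda>x. ennreal (?f (sqrt A * x)))
      = (\<lambda>x. ennreal (sqrt A * A ^ k) * ennreal (indicator {0..} x * (exp (- A * x\<^sup>2) * x ^ (2 * k + 1))))"
  proof
    fix x :: real
    have "?f (sqrt A * x) = sqrt A * A ^ k * (indicator {0..} x * (exp (- A * x\<^sup>2) * x ^ (2 * k + 1)))"
      using assms by (auto simp: indicator_def power_mult_distrib power_mult zero_le_mult_iff)
    then show "ennreal (?f (sqrt A * x)) = ennreal (sqrt A * A ^ k) * ennreal (indicator {0..} x * (exp (- A * x\<^sup>2) * x ^ (2 * k + 1)))"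
      using assms by (simp only: ennreal_mult' mult_nonneg_nonneg real_sqrt_ge_zero less_imp_le zero_le_power)
  qed
  also have "ennreal (sqrt A) * (\<integral>\<^sup>+x. ennreal (sqrt A * A ^ k) *
      ennreal (indicator {0..} x * (exp (- A * x\<^sup>2) * x ^ (2 * k + 1))) \<partial>lborel) = ennreal (A ^ (k + 1)) * ?I"
    using assms by (subst nn_integral_cmult) (simp_all add: mult.assoc[symmetric] ennreal_mult[symmetric])
  finally have "ennreal (1 / A ^ (k + 1)) * ennreal (fact k / 2) = ennreal (1 / A ^ (k + 1)) * ennreal (A ^ (k + 1)) * ?I"
    by (simp only: mult.assoc)
  also have "ennreal (1 / A ^ (k + 1)) * ennreal (A ^ (k + 1)) = 1"
    using assms by (simp add: ennreal_mult[symmetric])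
  finally show ?thesis
    using assms by (simp add: ennreal_mult[symmetric] mult.commute)
qed

section \<open>Convergence and continuity of the confluent hypergeometric series\<close>

text \<open>Each step multiplies the Pochhammer quotient by \<open>(2 + k) / (1/2 + k)\<close>,
  which is at most 4 with equality at \<open>k = 0\<close>. The series is thereby dominated by the
  exponential series at \<open>4 * \<bar>x\<bar>\<close>.\<close>

lemma hypergeom_1F1_coeff_le: "pochhammer 2 k / pochhammer (1/2) k / fact k \<le> (4::real) ^ k / fact k"
proof -
  have "pochhammer 2 k \<le> (4::real) ^ k * pochhammer (1/2) k \<and> 0 < (pochhammer (1/2) k :: real)" for k
  proof (induction k)
    case (Suc k)
    have "pochhammer 2 (Suc k) = pochhammer (2::real) k * (2 + real k)" by (simp add: pochhammer_Suc)
    also have "\<dots> \<le> (4 ^ k * pochhammer (1/2) k) * (4 * (1/2 + real k))"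
      using Suc by (intro mult_mono) auto
    also have "\<dots> = 4 ^ Suc k * pochhammer (1/2) (Suc k)" by (simp add: pochhammer_Suc)
    finally show ?case using Suc by (simp add: pochhammer_Suc)
  qed simp
  from this[of k] show ?thesis
    by (intro divide_right_mono) (simp_all add: pos_divide_le_eq)
qed

lemma summable_hypergeom_1F1:
  "summable (\<lambda>k. pochhammer 2 k / pochhammer (1/2) k / fact k * x ^ k :: real)"
proof (rule summable_comparison_test')
  show "summable (\<lambda>k. (4 * \<bar>x\<bar>) ^ k /\<^sub>R fact k)"
    using summable_exp_generic[of "4 * \<bar>x\<bar>"] by simp
  fix k :: nat assume "0 \<le> k"
  have "\<bar>pochhammer 2 k / pochhammer (1/2) k / fact k\<bar> = pochhammer 2 k / pochhammer (1/2) k / (fact k :: real)"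
    by (simp add: pochhammer_nonneg)
  then show "norm (pochhammer 2 k / pochhammer (1/2) k / fact k * x ^ k) \<le> (4 * \<bar>x\<bar>) ^ k /\<^sub>R fact k"
    using mult_right_mono[OF hypergeom_1F1_coeff_le[of k], of "\<bar>x\<bar> ^ k"]
    by (simp only: real_norm_def abs_mult power_abs)
       (simp add: power_mult_distrib divide_simps)
qed

text \<open>Moves the factorial into the coefficient, giving the shape expected by power series
  lemmas.\<close>

lemma hypergeom_1F1_2_half:
  "hypergeom_1F1 2 (1/2) = (\<lambda>x. \<Sum>k. pochhammer 2 k / pochhammer (1/2) k / fact k * x ^ k)"
  by (simp add: hypergeom_1F1_def fun_eq_iff)

lemma isCont_hypergeom_1F1: "isCont (hypergeom_1F1 2 (1/2)) x"
  unfolding hypergeom_1F1_2_half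
  by (rule isCont_powser_converges_everywhere) (rule summable_hypergeom_1F1)

lemma hypergeom_1F1_nonneg: "0 \<le> x \<Longrightarrow> 0 \<le> hypergeom_1F1 2 (1/2) x"
  unfolding hypergeom_1F1_2_half
  by (rule suminf_nonneg[OF summable_hypergeom_1F1]) (simp add: pochhammer_nonneg)

section \<open>The radial integral as a hypergeometric value\<close>

lemma nn_integral_radial:
  fixes A B :: real assumes A: "A > 0"
  shows "(\<integral>\<^sup>+r. ennreal (\<bar>r\<bar> ^ 3 * exp (- A * r\<^sup>2 + 2 * B * r)) \<partial>lborel)
    = ennreal (hypergeom_1F1 2 (1/2) (B\<^sup>2 / A) * (1 / A\<^sup>2))"
proof -
  \<comment> \<open>The terms of the series of
    \<open>2 * r ^ 3 * exp (- A * r\<^sup>2) * cosh (2 * B * r)\<close> on the half-line. The power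
    \<open>r ^ (2 * k + 3)\<close> makes the Gaussian moment the one of index \<open>k + 1\<close>.
    All terms are nonnegative, so sum and integral may be exchanged.\<close>
  define t where "t = (\<lambda>k r. 2 * (2 * B) ^ (2 * k) / fact (2 * k) *
      (indicator {0..} r * (exp (- A * r\<^sup>2) * r ^ (2 * (k + 1) + 1))))"
  have t_nonneg: "0 \<le> t k r" for k r
    by (auto simp: t_def indicator_def)
  have t_sums: "(\<lambda>k. t k r) sums (indicator {0..} r *
      (\<bar>r\<bar> ^ 3 * exp (- A * r\<^sup>2 + 2 * B * r) + \<bar>- r\<bar> ^ 3 * exp (- A * (- r)\<^sup>2 + 2 * B * - r)))" for r
  proof -
    \<comment> \<open>This form of the series has zeros at odd indices; reindexing along
      \<open>2 * k\<close> drops them.\<close>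
    have "(\<lambda>n. if even n then (2 * B * r) ^ n /\<^sub>R fact n else 0) sums cosh (2 * B * r)"
      by (rule cosh_converges)
    then have "(\<lambda>k. (2 * B * r) ^ (2 * k) / fact (2 * k)) sums cosh (2 * B * r)"
      by (subst (asm) sums_mono_reindex[of "\<lambda>k. 2 * k", symmetric])
         (auto simp: strict_mono_def divide_inverse mult.commute elim!: evenE)
    then have "(\<lambda>k. indicator {0..} r * (2 * r ^ 3 * exp (- A * r\<^sup>2)) * ((2 * B * r) ^ (2 * k) / fact (2 * k))) sums
        (indicator {0..} r * (2 * r ^ 3 * exp (- A * r\<^sup>2)) * cosh (2 * B * r))"
      by (rule sums_mult)
    moreover have "indicator {0..} r * (2 * r ^ 3 * exp (- A * r\<^sup>2)) * ((2 * B * r) ^ (2 * k) / fact (2 * k)) = t k r" for k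
      by (simp add: t_def power_mult_distrib power_add power3_eq_cube power2_eq_square)
    moreover have "indicator {0..} r * (2 * r ^ 3 * exp (- A * r\<^sup>2)) * cosh (2 * B * r)
      = indicator {0..} r *
      (\<bar>r\<bar> ^ 3 * exp (- A * r\<^sup>2 + 2 * B * r) + \<bar>- r\<bar> ^ 3 * exp (- A * (- r)\<^sup>2 + 2 * B * - r))"
    proof (cases "r \<ge> 0")
      case True
      have "cosh (2 * B * r) = (exp (2 * B * r) + exp (2 * B * - r)) / 2" by (simp add: cosh_def)
      with True show ?thesis by (simp only: exp_add) (simp add: algebra_simps)
    qed auto
    ultimately show ?thesis by (simp only:)
  qed
  have "(\<integral>\<^sup>+r. ennreal (\<bar>r\<bar> ^ 3 * exp (- A * r\<^sup>2 + 2 * B * r)) \<partial>lborel)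
      = (\<integral>\<^sup>+r. (\<Sum>k. ennreal (t k r)) \<partial>lborel)"
  proof (subst nn_integral_even_part, simp, rule nn_integral_cong)
    fix r
    show "indicator {0..} r * (ennreal (\<bar>r\<bar> ^ 3 * exp (- A * r\<^sup>2 + 2 * B * r)) +
        ennreal (\<bar>- r\<bar> ^ 3 * exp (- A * (- r)\<^sup>2 + 2 * B * - r))) = (\<Sum>k. ennreal (t k r))"
      unfolding suminf_ennreal2[OF t_nonneg sums_summable[OF t_sums]] sums_unique[OF t_sums[of r], symmetric]
      by (cases "0 \<le> r") (simp_all del: ennreal_plus add: ennreal_plus[symmetric])
  qed
  also have "\<dots> = (\<Sum>k. \<integral>\<^sup>+r. ennreal (t k r) \<partial>lborel)"
    by (rule nn_integral_suminf) (simp add: t_def)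
  also have "(\<lambda>k. \<integral>\<^sup>+r. ennreal (t k r) \<partial>lborel)
      = (\<lambda>k. ennreal (pochhammer 2 k / pochhammer (1/2) k / fact k * (B\<^sup>2 / A) ^ k * (1 / A\<^sup>2)))"
  proof
    fix k
    have c: "2 * (2 * B) ^ (2 * k) / fact (2 * k) \<ge> 0" by simp
    have "(\<integral>\<^sup>+r. ennreal (t k r) \<partial>lborel)
        = ennreal (2 * (2 * B) ^ (2 * k) / fact (2 * k)) * ennreal (fact (k + 1) / (2 * A ^ (k + 1 + 1)))"
      unfolding t_def ennreal_mult'[OF c]
      by (subst nn_integral_cmult) (simp_all only: nn_integral_gaussian_moment_odd[OF A], simp)
    also have "\<dots> = ennreal (2 * (2 * B) ^ (2 * k) / fact (2 * k) * (fact (k + 1) / (2 * A ^ (k + 1 + 1))))"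
      using A by (simp only: ennreal_mult'[OF c])
    also have "2 * (2 * B) ^ (2 * k) / fact (2 * k) * (fact (k + 1) / (2 * A ^ (k + 1 + 1)))
        = pochhammer 2 k / pochhammer (1/2) k / fact k * (B\<^sup>2 / A) ^ k * (1 / A\<^sup>2)"
    proof -
      \<comment> \<open>Origin of the two parameters: the moment gives
        \<open>(k + 1)! = (2)_k\<close>, and the duplication formula gives
        \<open>(2k)! = 4^k (1/2)_k k!\<close>, whose \<open>4^k\<close> cancels against
        \<open>(2 * B) ^ (2 * k)\<close>.\<close>
      have "fact (k + 1) = (pochhammer 2 k :: real)"
        using pochhammer_rec[of "1::real" k] by (simp add: pochhammer_fact)
      moreover have "(2 * B) ^ (2 * k) = 2 ^ (2 * k) * (B\<^sup>2) ^ k"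
        by (simp add: power_mult_distrib power_mult)
      moreover have "A ^ (k + 1 + 1) = A ^ k * A\<^sup>2" by (simp add: power2_eq_square)
      ultimately have "2 * (2 * B) ^ (2 * k) / fact (2 * k) * (fact (k + 1) / (2 * A ^ (k + 1 + 1)))
          = 2 * (2 ^ (2 * k) * (B\<^sup>2) ^ k) / (2 ^ (2 * k) * pochhammer (1/2) k * fact k) * (pochhammer 2 k / (2 * (A ^ k * A\<^sup>2)))"
        by (simp only: fact_double)
      also have "\<dots> = pochhammer 2 k / pochhammer (1/2) k / fact k * ((B\<^sup>2) ^ k / A ^ k) * (1 / A\<^sup>2)"
        by (simp add: ac_simps)
      finally show ?thesis
        by (simp only: power_divide)
    qed
    finally show "(\<integral>\<^sup>+r. ennreal (t k r) \<partial>lborel)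
      = ennreal (pochhammer 2 k / pochhammer (1/2) k / fact k * (B\<^sup>2 / A) ^ k * (1 / A\<^sup>2))" .
  qed
  also have "(\<Sum>k. ennreal (pochhammer 2 k / pochhammer (1/2) k / fact k * (B\<^sup>2 / A) ^ k * (1 / A\<^sup>2)))
      = ennreal (\<Sum>k. pochhammer 2 k / pochhammer (1/2) k / fact k * (B\<^sup>2 / A) ^ k * (1 / A\<^sup>2))"
    using A by (intro suminf_ennreal2 summable_mult2 summable_hypergeom_1F1) (simp add: pochhammer_nonneg)
  also have "(\<Sum>k. pochhammer 2 k / pochhammer (1/2) k / fact k * (B\<^sup>2 / A) ^ k * (1 / A\<^sup>2))
      = hypergeom_1F1 2 (1/2) (B\<^sup>2 / A) * (1 / A\<^sup>2)"
    unfolding hypergeom_1F1_2_half by (rule suminf_mult2[symmetric, OF summable_hypergeom_1F1])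
  finally show ?thesis .
qed

section \<open>Augmented covariance matrices\<close>

abbreviation ip :: "complex^'n \<Rightarrow> complex^'n \<Rightarrow> complex" where
  "ip x y \<equiv> scalar_product (cnj_vec x) y"

lemma scalar_product_add:
  "scalar_product (x + y) z = scalar_product x z + scalar_product y z"
  "scalar_product x (y + z) = scalar_product x y + scalar_product x z"
  by (simp_all add: scalar_product_def algebra_simps sum.distrib)

lemma scalar_product_diff:
  fixes x y z :: "'a::ring_1^'n"
  shows "scalar_product (x - y) z = scalar_product x z - scalar_product y z"
    "scalar_product x (y - z) = scalar_product x y - scalar_product x z"
  by (simp_all add: scalar_product_def algebra_simps sum_subtractf)

lemma scalar_product_scale:
  fixes x y :: "'a::comm_ring_1^'n"
  shows "scalar_product (c *s x) y = c * scalar_product x y"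
    "scalar_product x (c *s y) = c * scalar_product x y"
  by (simp_all add: scalar_product_def sum_distrib_left mult_ac)

lemma scalar_product_commute:
  fixes x y :: "'a::comm_ring_1^'n"
  shows "scalar_product x y = scalar_product y x"
  by (simp add: scalar_product_def mult.commute)

lemma scalar_product_vector_matrix:
  fixes x :: "'a::comm_ring_1^'m" and A :: "'a^'n^'m"
  shows "scalar_product (x v* A) y = scalar_product x (A *v y)"
proof -
  have "scalar_product (x v* A) y = (\<Sum>j\<in>UNIV. \<Sum>i\<in>UNIV. x $ i * A $ i $ j * y $ j)"
    by (simp only: scalar_product_def vector_matrix_mult_def vec_lambda_beta sum_distrib_right)
  also have "\<dots> = (\<Sum>i\<in>UNIV. \<Sum>j\<in>UNIV. x $ i * A $ i $ j * y $ j)"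
    by (rule sum.swap)
  finally show ?thesis
    by (simp only: scalar_product_def matrix_vector_mult_def vec_lambda_beta sum_distrib_left mult.assoc)
qed

lemma scalar_product_transpose:
  fixes x :: "'a::comm_ring_1^'m" and A :: "'a^'n^'m"
  shows "scalar_product x (A *v y) = scalar_product (transpose A *v x) y"
  by (simp add: scalar_product_vector_matrix[symmetric])

lemma scalar_product_stack:
  "scalar_product (stack a b) (stack c d) = scalar_product a c + scalar_product b d"
  by (simp add: scalar_product_def stack_def UNIV_Plus_UNIV[symmetric] sum.Plus del: UNIV_Plus_UNIV)

text \<open>Lets identities between block matrices be checked on stacked vectors only.\<close>

lemma stack_cases:
  obtains a b where "x = stack a b"
proof
  show "x = stack (\<chi> i. x $ Inl i) (\<chi> i. x $ Inr i)"
    by (simp add: stack_def vec_eq_iff split: sum.split)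
qed

lemma stack_nth [simp]: "stack a b $ Inl i = a $ i" "stack a b $ Inr j = b $ j"
  by (simp_all add: stack_def)

lemma stack_eq_iff: "stack a b = stack c d \<longleftrightarrow> a = c \<and> b = d"
proof
  assume eq: "stack a b = stack c d"
  have "a $ i = c $ i" "b $ j = d $ j" for i j
    using arg_cong[OF eq, of "\<lambda>x. x $ Inl i"] arg_cong[OF eq, of "\<lambda>x. x $ Inr j"] by simp_all
  then show "a = c \<and> b = d" by (simp add: vec_eq_iff)
qed simp

lemma stack_diff: "stack a b - stack c d = stack (a - c) (b - d)"
  by (simp add: stack_def vec_eq_iff split: sum.split)

lemma block_mat_mult_stack:
  fixes A :: "'a::semiring_1^'n^'m"
  shows "block_mat A B C D *v stack x y = stack (A *v x + B *v y) (C *v x + D *v y)"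
  by (simp add: vec_eq_iff block_mat_def stack_def matrix_vector_mult_def
      UNIV_Plus_UNIV[symmetric] sum.Plus del: UNIV_Plus_UNIV split: sum.split)

lemma cnj_vec_cnj_vec [simp]: "cnj_vec (cnj_vec x) = x"
  by (simp add: cnj_vec_def vec_eq_iff)

lemma cnj_mat_cnj_mat [simp]: "cnj_mat (cnj_mat A) = A"
  by (simp add: cnj_mat_def vec_eq_iff)

lemma cnj_vec_add: "cnj_vec (x + y) = cnj_vec x + cnj_vec y"
  by (simp add: cnj_vec_def vec_eq_iff)

lemma cnj_vec_diff: "cnj_vec (x - y) = cnj_vec x - cnj_vec y"
  by (simp add: cnj_vec_def vec_eq_iff)

lemma cnj_vec_scale: "cnj_vec (c *s x) = cnj c *s cnj_vec x"
  by (simp add: cnj_vec_def vec_eq_iff)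

lemma cnj_vec_0 [simp]: "cnj_vec 0 = 0"
  by (simp add: cnj_vec_def vec_eq_iff)

lemma cnj_vec_eq_0_iff [simp]: "cnj_vec x = 0 \<longleftrightarrow> x = 0"
  by (simp add: cnj_vec_def vec_eq_iff)

lemma cnj_vec_stack: "cnj_vec (stack a b) = stack (cnj_vec a) (cnj_vec b)"
  by (simp add: cnj_vec_def stack_def vec_eq_iff split: sum.split)

lemma cnj_vec_mult: "cnj_vec (A *v x) = cnj_mat A *v cnj_vec x"
  by (simp add: cnj_vec_def cnj_mat_def matrix_vector_mult_def vec_eq_iff)

lemma cnj_mat_mult: "cnj_mat (A ** B) = cnj_mat A ** cnj_mat B"
  by (simp add: cnj_mat_def matrix_matrix_mult_def vec_eq_iff)

lemma cnj_mat_1 [simp]: "cnj_mat (mat 1) = mat 1"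
  by (simp add: cnj_mat_def mat_def vec_eq_iff)

lemma transpose_cnj_mat: "transpose (cnj_mat A) = cnj_mat (transpose A)"
  by (simp add: cnj_mat_def transpose_def vec_eq_iff)

lemma cnj_scalar_product: "cnj (scalar_product x y) = scalar_product (cnj_vec x) (cnj_vec y)"
  by (simp add: scalar_product_def cnj_vec_def)

lemma cnj_ip: "cnj (ip x y) = ip y x"
  by (simp add: cnj_scalar_product scalar_product_commute)

lemma ip_mult_left: "ip (A *v x) y = ip x (conj_transpose A *v y)"
  unfolding cnj_vec_mult conj_transpose_def transpose_cnj_mat[symmetric]
  by (metis scalar_product_commute scalar_product_transpose)

lemma hermitian_transpose: "hermitian A \<Longrightarrow> transpose A = cnj_mat A"
  unfolding hermitian_def conj_transpose_def by (metis cnj_mat_cnj_mat)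

lemma hermitian_nth:
  assumes "hermitian A" shows "cnj (A $ i $ j) = A $ j $ i"
proof -
  have "cnj (A $ i $ j) = cnj_mat A $ i $ j" by (simp add: cnj_mat_def)
  also have "cnj_mat A = transpose A" using assms by (simp add: hermitian_transpose)
  finally show ?thesis by (simp add: transpose_def)
qed

lemma cnj_sesq_form: "hermitian A \<Longrightarrow> cnj (sesq_form x A y) = sesq_form y A x"
  by (simp add: sesq_form_def cnj_ip ip_mult_left hermitian_def)

lemma uminus_matrix_vector_mult:
  fixes A :: "'a::ring_1^'n^'m"
  shows "(- A) *v x = - (A *v x)"
  by (simp add: matrix_vector_mult_def vec_eq_iff sum_negf)

lemma matrix_vector_mult_scale:
  fixes A :: "'a::comm_ring_1^'n^'m"
  shows "A *v (c *s x) = c *s (A *v x)"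
  by (simp add: matrix_vector_mult_def vec_eq_iff sum_distrib_left mult_ac)

section \<open>Inverses, positive definiteness and determinants\<close>

lemma matrix_inv_mult:
  assumes "invertible A"
  shows "A ** matrix_inv A = mat 1" "matrix_inv A ** A = mat 1"
  using someI_ex[OF assms[unfolded invertible_def]] by (simp_all add: matrix_inv_def)

lemma matrix_inv_unique:
  fixes A :: "'a::field^'n^'n"
  assumes "A ** B = mat 1"
  shows "invertible A" "matrix_inv A = B"
proof -
  show "invertible A" using assms by (auto simp: invertible_right_inverse)
  then show "matrix_inv A = B"
    by (metis assms matrix_inv_mult(2) matrix_mul_assoc matrix_mul_lid matrix_mul_rid)
qed

lemma hermitian_matrix_inv:
  assumes "hermitian A" "invertible A"
  shows "hermitian (matrix_inv A)"
proof -
  have "A ** conj_transpose (matrix_inv A) = conj_transpose (matrix_inv A ** A)"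
    using assms(1) by (simp add: conj_transpose_def matrix_transpose_mul cnj_mat_mult hermitian_def)
  also have "\<dots> = mat 1"
    using assms(2) by (simp add: matrix_inv_mult conj_transpose_def transpose_mat)
  finally show ?thesis
    unfolding hermitian_def by (metis matrix_inv_unique(2))
qed

text \<open>A kernel vector would make the form \<open>x^* A x\<close> vanish.\<close>

lemma pos_def_invertible:
  assumes "pos_def A" shows "invertible A"
proof -
  have "x = 0" if "A *v x = 0" for x
    using assms that by (force simp: pos_def_def sesq_form_def scalar_product_def)
  then show ?thesis
    by (simp add: invertible_left_inverse matrix_left_invertible_ker)
qed

lemma Re_sesq_form_nonneg:
  assumes "pos_def A" shows "0 \<le> Re (sesq_form x A x)"
proof (cases "x = 0")
  case True
  then show ?thesis by (simp add: sesq_form_def scalar_product_def)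
next
  case False
  then show ?thesis using assms by (auto simp: pos_def_def intro: less_imp_le)
qed

text \<open>One direction of Sylvester's criterion in dimension two, obtained by evaluating the form
  at two test vectors.\<close>

lemma pos_def_matrix_2:
  fixes A :: "complex^2^2"
  assumes "pos_def A"
  shows "Im (det A) = 0" "Re (det A) > 0"
proof -
  have herm: "cnj (A $ i $ j) = A $ j $ i" for i j
    using assms by (simp add: pos_def_def hermitian_nth)
  have im: "Im (A $ i $ i) = 0" for i
    using arg_cong[OF herm[of i i], of Im] by simp
  note h = herm[of 1 2, symmetric]
  show "Im (det A) = 0"
    by (subst det_2, subst h) (simp add: im)
  have pos: "0 < Re (sesq_form x A x)" if "x \<noteq> 0" for x
    using assms that by (simp add: pos_def_def)
  have "0 < Re (sesq_form (vector [1, 0]) A (vector [1, 0]))"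
    by (rule pos) (simp add: vec_eq_iff forall_2)
  then have a: "0 < Re (A $ 1 $ 1)"
    by (simp add: sesq_form_def scalar_product_def cnj_vec_def matrix_vector_mult_def sum_2)
  \<comment> \<open>This vector is orthogonal to the first row: \<open>A\<close> maps it to
    \<open>(0, det A)\<close>, so its form is the upper left entry times the determinant.\<close>
  have "0 < Re (sesq_form (vector [- (A $ 1 $ 2), A $ 1 $ 1]) A (vector [- (A $ 1 $ 2), A $ 1 $ 1]))"
    using a by (intro pos) (auto simp: vec_eq_iff forall_2)
  also have "\<dots> = Re (A $ 1 $ 1) * Re (det A)"
    by (simp add: det_2 sesq_form_def scalar_product_def cnj_vec_def matrix_vector_mult_def sum_2 im algebra_simps)
  finally show "Re (det A) > 0"
    using a by (simp add: zero_less_mult_iff)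
qed

lemma UNIV_2_2: "(UNIV :: (2 + 2) set) = {Inl 1, Inl 2, Inr 1, Inr 2}"
  by (auto simp: UNIV_Plus_UNIV[symmetric] UNIV_2 simp del: UNIV_Plus_UNIV)

text \<open>Expansion over the permutations of the four indices, peeling off one index at a time.
  Both triangular shapes occur in the factorisation of the augmented covariance matrix.\<close>

lemma det_block_mat_2:
  fixes A B C D :: "'a::comm_ring_1^2^2"
  shows "C = 0 \<Longrightarrow> det (block_mat A B C D) = det A * det D"
    "B = 0 \<Longrightarrow> det (block_mat A B C D) = det A * det D"
proof -
  have f1: "finite {Inl 2, Inr 1, Inr (2::2)}" "Inl 1 \<notin> {Inl (2::2), Inr 1, Inr (2::2)}" by auto
  have f2: "finite {Inr 1, Inr (2::2)}" "Inl (2::2) \<notin> {Inr 1, Inr (2::2)}" by auto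
  have f3: "finite {Inr (2::2)}" "Inr 1 \<notin> {Inr (2::2)}" by auto
  show "C = 0 \<Longrightarrow> det (block_mat A B C D) = det A * det D"
    unfolding det_2 unfolding det_def UNIV_2_2
    unfolding sum_over_permutations_insert[OF f1]
    unfolding sum_over_permutations_insert[OF f2]
    unfolding sum_over_permutations_insert[OF f3]
    unfolding permutes_sing
    by (simp add: sign_swap_id permutation_swap_id permutation_compose sign_compose sign_id swap_id_eq block_mat_def stack_def algebra_simps)
  show "B = 0 \<Longrightarrow> det (block_mat A B C D) = det A * det D"
    unfolding det_2 unfolding det_def UNIV_2_2
    unfolding sum_over_permutations_insert[OF f1]
    unfolding sum_over_permutations_insert[OF f2]
    unfolding sum_over_permutations_insert[OF f3]
    unfolding permutes_sing
    by (simp add: sign_swap_id permutation_swap_id permutation_compose sign_compose sign_id swap_id_eq block_mat_def stack_def algebra_simps)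
qed

section \<open>The inverse augmented covariance matrix and its quadratic form\<close>

locale admissible =
  fixes \<Gamma> C :: "complex^'n^'n"
  assumes pos_def_Gamma: "pos_def \<Gamma>" and symmetric_C: "transpose C = C"
    and pos_def_P: "pos_def (P_mat \<Gamma> C)"
begin

definition G :: "complex^'n^'n" where "G = matrix_inv \<Gamma>"
definition N :: "complex^'n^'n" where "N = matrix_inv (P_mat \<Gamma> C)"
text \<open>The matrix of the bilinear term in \<open>A_fun\<close>, and up to sign the lower left
  block of \<open>S\<close>.\<close>

definition K :: "complex^'n^'n" where "K = transpose (R_mat \<Gamma> C) ** cnj_mat N"
definition S :: "complex^('n+'n)^('n+'n)" where "S = matrix_inv (aug_cov \<Gamma> C)"

lemma G: "\<Gamma> ** G = mat 1" "G ** \<Gamma> = mat 1"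
  using matrix_inv_mult[OF pos_def_invertible[OF pos_def_Gamma]] by (simp_all add: G_def)

lemma hermitian_Gamma: "hermitian \<Gamma>" and hermitian_G: "hermitian G"
  using pos_def_Gamma hermitian_matrix_inv[OF _ pos_def_invertible[OF pos_def_Gamma]]
  by (simp_all add: pos_def_def G_def)

lemma P_N: "P_mat \<Gamma> C ** N = mat 1"
  using matrix_inv_mult[OF pos_def_invertible[OF pos_def_P]] by (simp add: N_def)

lemma P_mult: "P_mat \<Gamma> C *v y = cnj_mat \<Gamma> *v y - cnj_mat C *v (G *v (C *v y))"
  by (simp only: P_mat_def G_def[symmetric] matrix_vector_mult_diff_rdistrib
      matrix_vector_mul_assoc matrix_mul_assoc)

lemma cnj_Gamma_N: "cnj_mat \<Gamma> *v (N *v y) - cnj_mat C *v (G *v (C *v (N *v y))) = y"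
  using P_mult[of "N *v y"] by (simp add: matrix_vector_mul_assoc P_N)

lemma K_eq: "K = cnj_mat G ** cnj_mat C ** cnj_mat N"
  by (simp add: K_def R_mat_def G_def[symmetric] matrix_transpose_mul transpose_cnj_mat symmetric_C
      hermitian_transpose[OF hermitian_G])

lemma cnj_K_mult: "cnj_mat K *v y = G *v (C *v (N *v y))"
  by (simp add: K_eq cnj_mat_mult matrix_vector_mul_assoc matrix_mul_assoc)

lemma K_mult: "K *v y = cnj_mat G *v (cnj_mat C *v (cnj_mat N *v y))"
  by (simp add: K_eq matrix_vector_mul_assoc matrix_mul_assoc)

lemma aug_cov_stack:
  fixes x y :: "complex^'n"
  shows "aug_cov \<Gamma> C *v stack x y = stack (\<Gamma> *v x + C *v y) (cnj_mat C *v x + cnj_mat \<Gamma> *v y)"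
  by (simp add: aug_cov_def block_mat_mult_stack)

text \<open>Block inversion through the Schur complement \<open>P_mat \<Gamma> C\<close>, verified
  on stacked vectors. Fact 1 is \<open>P N = 1\<close> solved for the term with conjugated
  \<open>\<Gamma>\<close>, and fact 2 is its conjugate.\<close>

lemma aug_cov_inverse:
  "aug_cov \<Gamma> C ** block_mat (cnj_mat N) (- cnj_mat K) (- K) N = mat 1"
proof -
  have G': "\<Gamma> *v (G *v y) = y" "cnj_mat \<Gamma> *v (cnj_mat G *v y) = y" for y
    using G(1) cnj_mat_mult[of \<Gamma> G, symmetric] by (simp_all add: matrix_vector_mul_assoc)
  have 1: "cnj_mat \<Gamma> *v (N *v y) = y + cnj_mat C *v (G *v (C *v (N *v y)))" for y
    using cnj_Gamma_N[of y] by (simp add: algebra_simps)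
  have 2: "\<Gamma> *v (cnj_mat N *v y) = y + C *v (cnj_mat G *v (cnj_mat C *v (cnj_mat N *v y)))" for y
    using arg_cong[OF 1[of "cnj_vec y"], of cnj_vec] by (simp add: cnj_vec_mult cnj_vec_add)
  have "aug_cov \<Gamma> C *v (block_mat (cnj_mat N) (- cnj_mat K) (- K) N *v stack x y) = stack x y" for x y
    by (simp add: aug_cov_stack block_mat_mult_stack uminus_matrix_vector_mult K_mult cnj_K_mult
        matrix_vector_mult_diff_distrib matrix_vector_right_distrib 1 2 G')
  then show ?thesis
    unfolding matrix_eq by (metis stack_cases matrix_vector_mul_assoc matrix_vector_mul_lid)
qed

lemma invertible_aug_cov: "invertible (aug_cov \<Gamma> C)"
  and S_eq: "S = block_mat (cnj_mat N) (- cnj_mat K) (- K) N"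
  using matrix_inv_unique[OF aug_cov_inverse] by (simp_all add: S_def)

text \<open>Inherited from the augmented covariance matrix, with Hermitian \<open>\<Gamma>\<close>
  and symmetric \<open>C\<close>. It makes the real form \<open>L\<close> symmetric.\<close>

lemma hermitian_S: "hermitian S"
proof -
  have "hermitian (aug_cov \<Gamma> C)"
  proof -
    have "C $ i $ j = C $ j $ i" for i j
      using arg_cong[OF symmetric_C, of "\<lambda>B. B $ i $ j"] by (simp add: transpose_def)
    then show ?thesis
      by (simp add: hermitian_def conj_transpose_def aug_cov_def block_mat_def stack_def
          cnj_mat_def transpose_def vec_eq_iff hermitian_nth[OF hermitian_Gamma] split: sum.split)
  qed
  then show ?thesis
    unfolding S_def by (rule hermitian_matrix_inv[OF _ invertible_aug_cov])
qed

text \<open>The augmented vectors form a real subspace invariant under \<open>S\<close>. Hence the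
  form of \<open>S\<close> on them is a number plus its conjugate.\<close>

lemma S_aug_vec: "S *v aug_vec z = aug_vec (cnj_mat N *v z - cnj_mat K *v cnj_vec z)"
  by (simp add: S_eq aug_vec_def block_mat_mult_stack uminus_matrix_vector_mult
      cnj_vec_diff cnj_vec_mult algebra_simps)

text \<open>Half the real bilinear form that \<open>S\<close> induces on augmented vectors.
  \<open>A_fun\<close> and \<open>B_fun\<close> turn out to be values of it.\<close>

definition L :: "complex^'n \<Rightarrow> complex^'n \<Rightarrow> real" where
  "L x z = Re (ip x (cnj_mat N *v z)) - Re (scalar_product x (K *v z))"

lemma sesq_form_S: "Re (sesq_form (aug_vec x) S (aug_vec z)) = 2 * L x z"
proof -
  let ?a = "cnj_mat N *v z - cnj_mat K *v cnj_vec z"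
  have "sesq_form (aug_vec x) S (aug_vec z) = ip x ?a + cnj (ip x ?a)"
    by (simp add: sesq_form_def S_aug_vec) (simp add: aug_vec_def cnj_vec_stack scalar_product_stack cnj_scalar_product)
  then have "Re (sesq_form (aug_vec x) S (aug_vec z)) = 2 * Re (ip x ?a)" by simp
  moreover have "Re (ip x (cnj_mat K *v cnj_vec z)) = Re (scalar_product x (K *v z))"
    using arg_cong[OF cnj_scalar_product[of x "K *v z"], of Re] by (simp add: cnj_vec_mult)
  ultimately show ?thesis by (simp add: L_def scalar_product_diff)
qed

lemma L_commute: "L x z = L z x"
  using sesq_form_S[of x z] sesq_form_S[of z x]
    arg_cong[OF cnj_sesq_form[OF hermitian_S, of "aug_vec x" "aug_vec z"], of Re] by simp

lemma L_diff: "L (x - y) z = L x z - L y z" "L x (y - z) = L x y - L x z"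
  by (simp_all add: L_def cnj_vec_diff scalar_product_diff matrix_vector_mult_diff_distrib)

text \<open>Restricted to real factors because \<open>L\<close> mixes a sesquilinear and a bilinear
  term; a phase must stay inside the argument.\<close>

lemma L_scale: "L (of_real r *s x) z = r * L x z" "L x (of_real r *s z) = r * L x z"
  by (simp_all add: L_def cnj_vec_scale scalar_product_scale matrix_vector_mult_scale algebra_simps)

text \<open>With \<open>a\<close> the upper half of \<open>S *v aug_vec z\<close>, one has
  \<open>z = \<Gamma> a + C cnj(a)\<close>. Completing the square writes \<open>2 * L z z\<close> as
  the \<open>\<Gamma>\<close>-form of \<open>a + g\<close> plus the \<open>P\<close>-form of the
  conjugate of \<open>a\<close>, where \<open>\<Gamma> g = C cnj(a)\<close>. The second summand is
  positive because \<open>a\<close> vanishes only if \<open>z\<close> does.\<close>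

lemma L_pos:
  assumes "z \<noteq> 0" shows "L z z > 0"
proof -
  define a where "a = cnj_mat N *v z - cnj_mat K *v cnj_vec z"
  define c where "c = C *v cnj_vec a"
  define g where "g = G *v c"
  have "aug_vec z = aug_cov \<Gamma> C *v (S *v aug_vec z)"
    using matrix_inv_mult(1)[OF invertible_aug_cov]
    by (simp add: S_def matrix_vector_mul_assoc)
  also have "\<dots> = stack (\<Gamma> *v a + c) (cnj_mat C *v a + cnj_mat \<Gamma> *v cnj_vec a)"
    by (simp add: S_aug_vec a_def[symmetric]) (simp add: aug_vec_def aug_cov_stack c_def)
  finally have z: "z = \<Gamma> *v a + c"
    by (simp add: aug_vec_def stack_eq_iff)
  have "a \<noteq> 0" using assms z by (auto simp: c_def)
  have Gg: "\<Gamma> *v g = c"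
    by (simp add: g_def matrix_vector_mul_assoc G)
  have herm: "ip (\<Gamma> *v x) y = ip x (\<Gamma> *v y)" for x y
    using hermitian_Gamma by (simp add: ip_mult_left hermitian_def)
  have d: "sesq_form (a + g) \<Gamma> (a + g) = ip a (\<Gamma> *v a) + ip a c + ip c a + ip g c"
    using herm[of g a]
    by (simp add: sesq_form_def matrix_vector_right_distrib cnj_vec_add scalar_product_add Gg)
  have P: "sesq_form (cnj_vec a) (P_mat \<Gamma> C) (cnj_vec a) = cnj (ip a (\<Gamma> *v a)) - ip c g"
  proof -
    have "P_mat \<Gamma> C *v cnj_vec a = cnj_vec (\<Gamma> *v a) - cnj_mat C *v g"
      by (simp add: P_mult cnj_vec_mult g_def c_def)
    moreover have "scalar_product a (cnj_mat C *v g) = ip c g"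
      by (simp only: c_def cnj_vec_mult cnj_vec_cnj_vec scalar_product_transpose[of a] transpose_cnj_mat symmetric_C)
    ultimately show ?thesis
      by (simp add: sesq_form_def scalar_product_diff cnj_scalar_product)
  qed
  have Re_eq: "Re (ip x y) = Re (ip y x)" for x y :: "complex^'n"
    using arg_cong[OF cnj_ip[of x y], of Re] by simp
  have "2 * L z z = 2 * Re (ip z a)"
    using arg_cong[OF cnj_scalar_product[of z "K *v z"], of Re]
    by (simp add: L_def a_def scalar_product_diff cnj_vec_mult)
  also have "\<dots> = 2 * Re (ip a z)" by (simp add: Re_eq)
  also have "\<dots> = Re (sesq_form (a + g) \<Gamma> (a + g)) + Re (sesq_form (cnj_vec a) (P_mat \<Gamma> C) (cnj_vec a))"
    unfolding d P z using Re_eq[of a c] Re_eq[of c g] by (simp add: scalar_product_add)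
  also have "\<dots> > 0"
    using Re_sesq_form_nonneg[OF pos_def_Gamma, of "a + g"] pos_def_P \<open>a \<noteq> 0\<close>
    by (auto simp: pos_def_def intro: add_nonneg_pos)
  finally show ?thesis by simp
qed

lemma aug_quad_eq: "aug_quad \<Gamma> C z = 2 * L z z"
  by (simp add: aug_quad_def sesq_form_S S_def[symmetric])

lemma quad_diff:
  "Re (sesq_form (aug_vec z - aug_vec \<mu>) S (aug_vec z - aug_vec \<mu>))
    = 2 * L z z - 4 * L \<mu> z + 2 * L \<mu> \<mu>"
proof -
  have "aug_vec z - aug_vec \<mu> = aug_vec (z - \<mu>)"
    by (simp add: aug_vec_def stack_diff cnj_vec_diff)
  then show ?thesis
    by (simp add: sesq_form_S L_diff L_commute[of z \<mu>])
qed

end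

text \<open>Block Gaussian elimination: removing \<open>R\<close> times the first block row clears
  the lower left block and leaves the Schur complement. The determinant can then be read
  off.\<close>

lemma (in admissible) aug_cov_factor:
  "aug_cov \<Gamma> C = block_mat (mat 1) 0 (R_mat \<Gamma> C) (mat 1) ** block_mat \<Gamma> C 0 (P_mat \<Gamma> C)"
proof -
  have R: "R_mat \<Gamma> C ** \<Gamma> = cnj_mat C"
    using G by (simp add: R_mat_def G_def[symmetric] matrix_mul_assoc[symmetric])
  have "aug_cov \<Gamma> C *v stack x y
      = (block_mat (mat 1) 0 (R_mat \<Gamma> C) (mat 1) ** block_mat \<Gamma> C 0 (P_mat \<Gamma> C)) *v stack x y" for x y
    using R by (simp add: aug_cov_stack matrix_vector_mul_assoc[symmetric] block_mat_mult_stack matrix_vector_right_distrib)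
      (simp add: matrix_vector_mul_assoc P_mat_def matrix_vector_mult_diff_rdistrib R_mat_def)
  then show ?thesis
    unfolding matrix_eq by (metis stack_cases)
qed

section \<open>The density of a ratio\<close>

lemma linear_re_im: "linear re_im"
  by (rule linearI) (simp_all add: re_im_def stack_def vec_eq_iff split: sum.split)

lemma inj_re_im: "inj re_im"
proof (rule injI)
  fix x y :: "complex^'n" assume eq: "re_im x = re_im y"
  have "x $ i = y $ i" for i
    using arg_cong[OF eq, of "\<lambda>v. v $ Inl i"] arg_cong[OF eq, of "\<lambda>v. v $ Inr i"]
    by (simp add: re_im_def complex_eq_iff)
  then show "x = y" by (simp add: vec_eq_iff)
qed

lemma of_re_im_re_im [simp]: "of_re_im (re_im z) = z"
  by (simp add: of_re_im_def re_im_def vec_eq_iff)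

lemma re_im_axis:
  "re_im (axis i 1) = axis (Inl i) 1" "re_im (axis i \<i>) = axis (Inr i) 1"
  by (auto simp: re_im_def stack_def axis_def vec_eq_iff split: sum.split)

lemma bij_betw_re_im_Basis: "bij_betw re_im (Basis :: (complex^'n) set) Basis"
proof -
  have B: "(Basis :: (complex^'n) set) = (\<Union>i. {axis i 1, axis i \<i>})"
    by (auto simp: Basis_vec_def Basis_complex_def)
  have "(Basis :: (real^('n+'n)) set) = range (\<lambda>i. axis i 1)"
    by (auto simp: Basis_vec_def)
  also have "\<dots> = (\<lambda>i. axis i 1) ` (range Inl \<union> range Inr)"
    by (metis UNIV_sum)
  also have "\<dots> = re_im ` Basis"
    by (auto simp: B re_im_axis image_Un image_UN)
  finally show ?thesis
    using inj_re_im by (auto simp: bij_betw_def intro: inj_on_subset)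
qed

lemma bij_betw_vector_Basis:
  "bij_betw (\<lambda>p. vector [fst p, snd p] :: complex^2) Basis Basis"
proof -
  have "(Basis :: (complex^2) set) = {axis 1 1, axis 1 \<i>, axis 2 1, axis 2 \<i>}"
    by (auto simp: Basis_vec_def Basis_complex_def UNIV_2)
  also have "\<dots> = (\<lambda>p. vector [fst p, snd p]) ` {(1, 0), (\<i>, 0), (0, 1), (0, \<i>)}"
  proof -
    have "(vector [x, 0] :: complex^2) = axis 1 x" "(vector [0, x] :: complex^2) = axis 2 x" for x
      by (simp_all add: axis_def vec_eq_iff forall_2)
    then show ?thesis by simp
  qed
  also have "{(1, 0), (\<i>, 0), (0, 1), (0, \<i>)} = (Basis :: (complex \<times> complex) set)"
    by (auto simp: Basis_prod_def Basis_complex_def)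
  finally show ?thesis
    by (auto simp: bij_betw_def inj_on_def vec_eq_iff forall_2)
qed

lemma bij_betw_vec_Basis: "bij_betw (vec :: complex \<Rightarrow> complex^1) Basis Basis"
proof -
  have "(vec x :: complex^1) = axis 1 x" for x
    by (simp add: axis_def vec_eq_iff)
  then have "(Basis :: (complex^1) set) = vec ` Basis"
    by (auto simp: Basis_vec_def)
  then show ?thesis
    by (auto simp: bij_betw_def inj_on_def vec_eq_iff)
qed

text \<open>A measure-preserving chart: densities are given on real vectors, whereas the
  substitution for the quotient takes place on pairs of complex numbers.\<close>

definition pair_coords :: "complex \<times> complex \<Rightarrow> real^(2+2)" where
  "pair_coords p = re_im (vector [fst p, snd p])"

definition single_coords :: "complex \<Rightarrow> real^(1+1)" where
  "single_coords q = re_im (vec q)"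

lemma linear_pair_coords: "linear pair_coords"
proof -
  have "linear (\<lambda>p. vector [fst p, snd p] :: complex^2)"
    by (rule linearI) (simp_all add: vec_eq_iff forall_2)
  from linear_compose[OF this linear_re_im] show ?thesis
    by (simp add: pair_coords_def[abs_def] comp_def)
qed

lemma linear_single_coords: "linear single_coords"
proof -
  have "linear (vec :: complex \<Rightarrow> complex^1)"
    by (rule linearI) (simp_all add: vec_eq_iff)
  from linear_compose[OF this linear_re_im] show ?thesis
    by (simp add: single_coords_def[abs_def] comp_def)
qed

lemma distr_pair_coords: "distr lborel lborel pair_coords = lborel"
  using bij_betw_trans[OF bij_betw_vector_Basis bij_betw_re_im_Basis]
  by (intro distr_lborel_Basis linear_pair_coords) (simp add: pair_coords_def[abs_def] comp_def)

lemma distr_single_coords: "distr lborel lborel single_coords = lborel"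
  using bij_betw_trans[OF bij_betw_vec_Basis bij_betw_re_im_Basis]
  by (intro distr_lborel_Basis linear_single_coords) (simp add: single_coords_def[abs_def] comp_def)

lemma measurable_coords [measurable]:
  "pair_coords \<in> borel_measurable borel" "single_coords \<in> borel_measurable borel"
  by (simp_all add: borel_measurable_linear linear_pair_coords linear_single_coords)

lemma of_re_im_pair_coords: "of_re_im (pair_coords p) = vector [fst p, snd p]"
  by (simp add: pair_coords_def)

lemma of_re_im_single_coords: "of_re_im (single_coords q) $ 1 = q"
  by (simp add: single_coords_def)

lemma measurable_of_re_im_nth [measurable]: "(\<lambda>x. of_re_im x $ i) \<in> borel_measurable borel"
proof -
  have "(\<lambda>x::real^('a+'a). x $ j) \<in> borel_measurable borel" for j
    by (rule borel_measurable_linear[OF bounded_linear.linear[OF bounded_linear_vec_nth]])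
  then show ?thesis
    unfolding of_re_im_def by simp
qed

section \<open>From a density of the pair to a density of the quotient\<close>

text \<open>Holds for an arbitrary density \<open>f\<close> of the pair: the law of the quotient is
  compared with the candidate on every Borel set \<open>E\<close>, by pulling back to complex pairs
  and applying \<open>nn_integral_ratio\<close>.\<close>

lemma has_complex_density_ratio:
  fixes Z :: "'a \<Rightarrow> complex^2" and f :: "complex^2 \<Rightarrow> real" and h :: "complex \<Rightarrow> real"
  assumes Z: "has_complex_density M Z f" and h_nonneg: "\<And>q. 0 \<le> h q"
    and h: "\<And>q. ennreal (h q) = (\<integral>\<^sup>+\<theta>. indicator {0<..<pi} \<theta> *
      (\<integral>\<^sup>+r. ennreal (\<bar>r\<bar> ^ 3) * ennreal (f (rcis r \<theta> *s qvec q)) \<partial>lborel) \<partial>lborel)"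
  shows "has_complex_density1 M (\<lambda>\<omega>. Z \<omega> $ 2 / Z \<omega> $ 1) h"
proof -
  let ?X = "\<lambda>\<omega>. re_im (Z \<omega>)" and ?f = "\<lambda>x. ennreal (f (of_re_im x))"
  let ?Y = "\<lambda>x. single_coords (of_re_im x $ 2 / of_re_im x $ 1)"
  define F where "F = (\<lambda>p. ?f (pair_coords p))"
  have distX: "distributed M lborel ?X ?f"
    using Z by (simp add: has_complex_density_def)
  then have [measurable]: "?f \<in> borel_measurable borel" and X[measurable]: "?X \<in> borel_measurable M"
    by (auto simp: distributed_def)
  have [measurable]: "F \<in> borel_measurable borel"
    unfolding F_def by measurable
  have ray: "ennreal (f (rcis r \<theta> *s qvec q)) = F (rcis r \<theta>, rcis r \<theta> * q)" for r \<theta> q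
  proof -
    have "rcis r \<theta> *s qvec q = vector [rcis r \<theta>, rcis r \<theta> * q]"
      by (simp add: qvec_def vec_eq_iff forall_2)
    then show ?thesis by (simp add: F_def of_re_im_pair_coords)
  qed
  \<comment> \<open>Measurability of \<open>h\<close> comes from its integral representation;
    nonnegativity makes \<open>enn2real\<close> recover \<open>h\<close> from its
    \<open>ennreal\<close> version.\<close>
  have h_meas [measurable]: "(\<lambda>q. ennreal (h q)) \<in> borel_measurable borel"
    unfolding h ray by measurable
  then have "(\<lambda>q. enn2real (ennreal (h q))) \<in> borel_measurable borel"
    by measurable
  then have [measurable]: "h \<in> borel_measurable borel"
    by (simp add: h_nonneg)
  have "(\<lambda>\<omega>. ?Y (?X \<omega>)) \<in> borel_measurable M"
    by measurable
  moreover have "distr M lborel (\<lambda>\<omega>. ?Y (?X \<omega>)) = density lborel (\<lambda>x. ennreal (h (of_re_im x $ 1)))"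
  proof (rule measure_eqI)
    fix E assume "E \<in> sets (distr M lborel (\<lambda>\<omega>. ?Y (?X \<omega>)))"
    then have [measurable]: "E \<in> sets borel" by simp
    have "emeasure (distr M lborel (\<lambda>\<omega>. ?Y (?X \<omega>))) E
        = (\<integral>\<^sup>+x. indicator E x \<partial>distr M lborel (\<lambda>\<omega>. ?Y (?X \<omega>)))"
      by simp
    also have "\<dots> = (\<integral>\<^sup>+\<omega>. indicator E (?Y (?X \<omega>)) \<partial>M)"
      by (rule nn_integral_distr) (simp_all del: of_re_im_re_im)
    also have "\<dots> = (\<integral>\<^sup>+x. ?f x * indicator E (?Y x) \<partial>lborel)"
      by (rule distributed_nn_integral[OF distX, symmetric]) simp
    also have "\<dots> = (\<integral>\<^sup>+p. ?f (pair_coords p) * indicator E (?Y (pair_coords p)) \<partial>lborel)"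
      by (subst distr_pair_coords[symmetric], rule nn_integral_distr) simp_all
    also have "\<dots> = (\<integral>\<^sup>+p. indicator E (single_coords (snd p / fst p)) * F p \<partial>lborel)"
      by (simp add: F_def of_re_im_pair_coords mult.commute)
    also have "\<dots> = (\<integral>\<^sup>+q. indicator E (single_coords q) * ennreal (h q) \<partial>lborel)"
      unfolding h ray by (rule nn_integral_ratio) simp_all
    also have "\<dots> = (\<integral>\<^sup>+q. ennreal (h (of_re_im (single_coords q) $ 1)) * indicator E (single_coords q) \<partial>lborel)"
      by (simp only: of_re_im_single_coords mult.commute)
    also have "\<dots> = (\<integral>\<^sup>+x. ennreal (h (of_re_im x $ 1)) * indicator E x \<partial>distr lborel lborel single_coords)"
      by (rule nn_integral_distr[symmetric]) simp_all
    also have "\<dots> = emeasure (density lborel (\<lambda>x. ennreal (h (of_re_im x $ 1)))) E"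
      by (simp add: distr_single_coords emeasure_density)
    finally show "emeasure (distr M lborel (\<lambda>\<omega>. ?Y (?X \<omega>))) E
        = emeasure (density lborel (\<lambda>x. ennreal (h (of_re_im x $ 1)))) E" .
  qed simp
  ultimately show ?thesis
    using h_nonneg
    by (simp add: has_complex_density1_def has_complex_density_def distributed_def single_coords_def)
qed

section \<open>The normal density along rays and the ratio density\<close>

locale admissible_2 = admissible \<Gamma> C for \<Gamma> C :: "complex^2^2"
begin

lemma det_aug_cov: "det (aug_cov \<Gamma> C) = det \<Gamma> * det (P_mat \<Gamma> C)"
  by (simp add: aug_cov_factor det_mul det_block_mat_2)

text \<open>Separates the constant from the part depending on \<open>z\<close>. Both determinants
  are real and positive, so \<open>Re\<close> is multiplicative here and the power
  \<open>-1/2\<close> is a reciprocal square root.\<close>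

lemma complex_normal_density_eq:
  "complex_normal_density \<mu> \<Gamma> C z =
    exp (- (1/2) * aug_quad \<Gamma> C \<mu>) / (pi\<^sup>2 * sqrt (Re (det \<Gamma>) * Re (det (P_mat \<Gamma> C)))) *
    exp (- L z z + 2 * L \<mu> z)"
proof -
  have "Re (det (aug_cov \<Gamma> C)) = Re (det \<Gamma>) * Re (det (P_mat \<Gamma> C))"
    by (simp add: det_aug_cov pos_def_matrix_2 pos_def_Gamma pos_def_P)
  moreover have "0 \<le> Re (det \<Gamma>) * Re (det (P_mat \<Gamma> C))"
    using pos_def_matrix_2(2)[OF pos_def_Gamma] pos_def_matrix_2(2)[OF pos_def_P] by simp
  ultimately have "Re (det (aug_cov \<Gamma> C)) powr (-1/2) = 1 / sqrt (Re (det \<Gamma>) * Re (det (P_mat \<Gamma> C)))"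
    by (simp add: powr_minus_divide powr_half_sqrt)
  moreover have "exp (- (1/2) * (2 * L z z - 4 * L \<mu> z + 2 * L \<mu> \<mu>))
      = exp (- (1/2) * (2 * L \<mu> \<mu>)) * exp (- L z z + 2 * L \<mu> z)"
    by (simp only: exp_add[symmetric]) (simp add: algebra_simps)
  ultimately show ?thesis
    by (simp only: complex_normal_density_def S_def[symmetric] quad_diff aug_quad_eq) simp
qed

text \<open>Absorb the phase into the vector: it cancels in the sesquilinear term and appears
  squared, as \<open>exp (2 * \<i> * of_real \<theta>)\<close>, in the bilinear one.\<close>

lemma
  shows A_fun_eq: "A_fun \<Gamma> C \<theta> q = L (cis \<theta> *s qvec q) (cis \<theta> *s qvec q)"
    and B_fun_eq: "B_fun \<mu> \<Gamma> C \<theta> q = L \<mu> (cis \<theta> *s qvec q)"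
proof -
  have "exp (2 * \<i> * of_real \<theta>) = cis \<theta> * cis \<theta>"
    by (simp add: cis_conv_exp exp_add[symmetric] mult.assoc)
  moreover have "cis \<theta> * (cnj (cis \<theta>) * x) = x" for x
    by (simp add: cis_cnj cis_mult mult.assoc[symmetric])
  ultimately show "A_fun \<Gamma> C \<theta> q = L (cis \<theta> *s qvec q) (cis \<theta> *s qvec q)"
    by (simp only: A_fun_def L_def sesq_form_def N_def[symmetric] K_def[symmetric] cnj_vec_scale
        scalar_product_scale matrix_vector_mult_scale mult.assoc)
  show "B_fun \<mu> \<Gamma> C \<theta> q = L \<mu> (cis \<theta> *s qvec q)"
    by (simp only: B_fun_def L_def N_def[symmetric] scalar_product_diff scalar_product_vector_matrix
        matrix_vector_mul_assoc K_def[symmetric] scalar_product_scale matrix_vector_mult_scale cis_conv_exp)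
       (simp add: algebra_simps)
qed

lemma A_fun_pos: "A_fun \<Gamma> C \<theta> q > 0"
proof -
  have "(cis \<theta> *s qvec q) $ 1 \<noteq> 0" by (simp add: qvec_def)
  then have "cis \<theta> *s qvec q \<noteq> 0" by (metis zero_index)
  then show ?thesis by (simp add: A_fun_eq L_pos)
qed

lemma L_rcis:
  "L (rcis r \<theta> *s qvec q) (rcis r \<theta> *s qvec q) = A_fun \<Gamma> C \<theta> q * r\<^sup>2"
  "L \<mu> (rcis r \<theta> *s qvec q) = B_fun \<mu> \<Gamma> C \<theta> q * r"
proof -
  have "rcis r \<theta> *s qvec q = of_real r *s (cis \<theta> *s qvec q)"
    by (simp add: rcis_def vec_eq_iff)
  then show "L (rcis r \<theta> *s qvec q) (rcis r \<theta> *s qvec q) = A_fun \<Gamma> C \<theta> q * r\<^sup>2"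
    "L \<mu> (rcis r \<theta> *s qvec q) = B_fun \<mu> \<Gamma> C \<theta> q * r"
    by (simp_all only: L_scale A_fun_eq B_fun_eq) (simp_all add: power2_eq_square)
qed

text \<open>The integrand is continuous because \<open>A_fun\<close> never vanishes. Integrability
  matters since \<open>integral\<close> defaults to 0 on non-integrable functions.\<close>

lemma
  fixes \<mu> :: "complex^2" and q :: complex
  defines "h \<equiv> \<lambda>\<theta>. hypergeom_1F1 2 (1/2) ((B_fun \<mu> \<Gamma> C \<theta> q)\<^sup>2 / A_fun \<Gamma> C \<theta> q) * (1 / (A_fun \<Gamma> C \<theta> q)\<^sup>2)"
  shows ratio_integrand_nonneg: "0 \<le> h \<theta>"
    and ratio_integrand_integrable: "h integrable_on {0..pi}"
proof -
  show "0 \<le> h \<theta>" for \<theta>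
    using A_fun_pos[of \<theta> q] by (simp add: h_def hypergeom_1F1_nonneg)
  have A: "continuous_on {0..pi} (\<lambda>\<theta>. A_fun \<Gamma> C \<theta> q)"
    and B: "continuous_on {0..pi} (\<lambda>\<theta>. B_fun \<mu> \<Gamma> C \<theta> q)"
    unfolding A_fun_def B_fun_def by (intro continuous_intros)+
  have A_nonzero: "\<forall>\<theta>\<in>{0..pi}. A_fun \<Gamma> C \<theta> q \<noteq> 0" "\<forall>\<theta>\<in>{0..pi}. (A_fun \<Gamma> C \<theta> q)\<^sup>2 \<noteq> 0"
    using A_fun_pos[of _ q] by (simp_all add: less_imp_neq[symmetric])
  have "continuous_on UNIV (hypergeom_1F1 2 (1/2))"
    by (simp add: continuous_on_eq_continuous_at isCont_hypergeom_1F1)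
  moreover have "continuous_on {0..pi} (\<lambda>\<theta>. (B_fun \<mu> \<Gamma> C \<theta> q)\<^sup>2 / A_fun \<Gamma> C \<theta> q)"
    by (intro continuous_on_divide continuous_on_power A B A_nonzero)
  ultimately have "continuous_on {0..pi} (\<lambda>\<theta>. hypergeom_1F1 2 (1/2) ((B_fun \<mu> \<Gamma> C \<theta> q)\<^sup>2 / A_fun \<Gamma> C \<theta> q))"
    by (rule continuous_on_compose2) simp
  then have "continuous_on {0..pi} h"
    unfolding h_def
    by (intro continuous_on_mult continuous_on_divide continuous_on_power continuous_on_const A A_nonzero)
  then show "h integrable_on {0..pi}"
    by (rule integrable_continuous_interval)
qed

lemma ratio_density_nonneg: "0 \<le> ratio_density \<mu> \<Gamma> C q"
  unfolding ratio_density_def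
  using pos_def_matrix_2(2)[OF pos_def_Gamma] pos_def_matrix_2(2)[OF pos_def_P]
  by (intro mult_nonneg_nonneg divide_nonneg_nonneg integral_nonneg ratio_integrand_nonneg
      ratio_integrand_integrable) simp_all

text \<open>Provides the hypothesis on \<open>h\<close> in \<open>has_complex_density_ratio\<close>;
  on each ray the constant factors out and \<open>nn_integral_radial\<close> evaluates the
  rest.\<close>

lemma ennreal_ratio_density:
  "ennreal (ratio_density \<mu> \<Gamma> C q) = (\<integral>\<^sup>+\<theta>. indicator {0<..<pi} \<theta> *
    (\<integral>\<^sup>+r. ennreal (\<bar>r\<bar> ^ 3) * ennreal (complex_normal_density \<mu> \<Gamma> C (rcis r \<theta> *s qvec q)) \<partial>lborel) \<partial>lborel)"
proof -
  define D where "D = exp (- (1/2) * aug_quad \<Gamma> C \<mu>) / (pi\<^sup>2 * sqrt (Re (det \<Gamma>) * Re (det (P_mat \<Gamma> C))))"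
  define h where "h = (\<lambda>\<theta>. hypergeom_1F1 2 (1/2) ((B_fun \<mu> \<Gamma> C \<theta> q)\<^sup>2 / A_fun \<Gamma> C \<theta> q) * (1 / (A_fun \<Gamma> C \<theta> q)\<^sup>2))"
  have D: "0 \<le> D"
    using pos_def_matrix_2(2)[OF pos_def_Gamma] pos_def_matrix_2(2)[OF pos_def_P] by (simp add: D_def)
  have h: "0 \<le> h \<theta>" for \<theta> unfolding h_def by (rule ratio_integrand_nonneg)
  have "(\<integral>\<^sup>+r. ennreal (\<bar>r\<bar> ^ 3) * ennreal (complex_normal_density \<mu> \<Gamma> C (rcis r \<theta> *s qvec q)) \<partial>lborel)
      = ennreal (D * h \<theta>)" for \<theta>
  proof -
    let ?A = "A_fun \<Gamma> C \<theta> q" and ?B = "B_fun \<mu> \<Gamma> C \<theta> q"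
    have "ennreal (\<bar>r\<bar> ^ 3) * ennreal (complex_normal_density \<mu> \<Gamma> C (rcis r \<theta> *s qvec q))
        = ennreal D * ennreal (\<bar>r\<bar> ^ 3 * exp (- ?A * r\<^sup>2 + 2 * ?B * r))" for r
      unfolding complex_normal_density_eq D_def[symmetric] L_rcis(1) L_rcis(2)[of \<mu>]
      using D by (simp add: ennreal_mult mult_ac)
    then have "(\<integral>\<^sup>+r. ennreal (\<bar>r\<bar> ^ 3) * ennreal (complex_normal_density \<mu> \<Gamma> C (rcis r \<theta> *s qvec q)) \<partial>lborel)
        = ennreal D * (\<integral>\<^sup>+r. ennreal (\<bar>r\<bar> ^ 3 * exp (- ?A * r\<^sup>2 + 2 * ?B * r)) \<partial>lborel)"
      by (simp only:) (rule nn_integral_cmult, simp)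
    also have "\<dots> = ennreal D * ennreal (h \<theta>)"
      by (simp only: nn_integral_radial[OF A_fun_pos] h_def)
    finally show ?thesis using D h by (simp add: ennreal_mult)
  qed
  then have "(\<integral>\<^sup>+\<theta>. indicator {0<..<pi} \<theta> *
      (\<integral>\<^sup>+r. ennreal (\<bar>r\<bar> ^ 3) * ennreal (complex_normal_density \<mu> \<Gamma> C (rcis r \<theta> *s qvec q)) \<partial>lborel) \<partial>lborel)
      = (\<integral>\<^sup>+\<theta>. indicator {0<..<pi} \<theta> * ennreal (D * h \<theta>) \<partial>lborel)"
    by (simp only:)
  also have "\<dots> = (\<integral>\<^sup>+\<theta>. ennreal (indicator {0..pi} \<theta> * (D * h \<theta>)) \<partial>lborel)"
  proof (rule nn_integral_cong_AE)
    \<comment> \<open>Polar coordinates use the open interval and \<open>ratio_density\<close> the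
      closed one; they differ by two points.\<close>
    show "AE \<theta> in lborel. indicator {0<..<pi} \<theta> * ennreal (D * h \<theta>) = ennreal (indicator {0..pi} \<theta> * (D * h \<theta>))"
      using AE_lborel_singleton[of 0] AE_lborel_singleton[of pi]
      by eventually_elim (auto simp: indicator_def)
  qed
  also have "\<dots> = ennreal (D * integral {0..pi} h)"
    using D h ratio_integrand_integrable[of \<mu> q, folded h_def]
    by (intro nn_integral_has_integral_lebesgue has_integral_mult_right integrable_integral) auto
  also have "D * integral {0..pi} h = ratio_density \<mu> \<Gamma> C q"
    by (simp only: ratio_density_def D_def h_def)
  finally show ?thesis by simp
qed

end

section \<open>The centred case without pseudo-covariance\<close>

lemma hypergeom_1F1_0: "hypergeom_1F1 a b 0 = 1"
proof -
  have "(\<lambda>k. pochhammer a k / pochhammer b k / fact k * 0 ^ k) sums (pochhammer a 0 / pochhammer b 0 / fact 0)"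
    by (rule powser_sums_zero)
  then show ?thesis
    by (simp add: hypergeom_1F1_def sums_iff)
qed

text \<open>For \<open>C = 0\<close> the Schur complement is the conjugate of
  \<open>\<Gamma>\<close> and \<open>R\<close> vanishes. Hence \<open>A_fun\<close> is constant in
  \<open>\<theta>\<close>, \<open>B_fun\<close> is 0, and integration yields a factor
  \<open>pi\<close> that cancels one of the two in the denominator. The square root reduces to
  \<open>det \<Gamma>\<close>, which is real and positive.\<close>

lemma ratio_density_circ_eq:
  assumes "pos_def \<Gamma>"
  shows "ratio_density 0 \<Gamma> 0 q = ratio_density_circ \<Gamma> q"
proof -
  let ?a = "Re (sesq_form (qvec q) (matrix_inv \<Gamma>) (qvec q))"
  have 0: "cnj_mat 0 = (0 :: complex^2^2)" "A ** 0 = (0 :: complex^2^2)" "0 ** A = (0 :: complex^2^2)"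
    "transpose 0 = (0 :: complex^2^2)" for A
    by (simp_all add: cnj_mat_def matrix_matrix_mult_def transpose_def vec_eq_iff)
  have P: "P_mat \<Gamma> 0 = cnj_mat \<Gamma>" and R: "R_mat \<Gamma> 0 = 0"
    by (simp_all add: P_mat_def R_mat_def 0)
  have "cnj_mat \<Gamma> ** cnj_mat (matrix_inv \<Gamma>) = mat 1"
    using matrix_inv_mult(1)[OF pos_def_invertible[OF assms]] by (simp add: cnj_mat_mult[symmetric])
  then have N: "cnj_mat (matrix_inv (P_mat \<Gamma> 0)) = matrix_inv \<Gamma>"
    by (simp add: P matrix_inv_unique(2))
  have A: "A_fun \<Gamma> 0 \<theta> q = ?a" for \<theta>
    by (simp add: A_fun_def N R 0 scalar_product_def)
  have B: "B_fun 0 \<Gamma> 0 \<theta> q = 0" for \<theta>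
    by (simp add: B_fun_def R 0 scalar_product_def)
  have "det (cnj_mat \<Gamma>) = cnj (det \<Gamma>)"
    by (simp add: det_2 cnj_mat_def)
  then have "sqrt (Re (det \<Gamma>) * Re (det (P_mat \<Gamma> 0))) = Re (det \<Gamma>)"
    using pos_def_matrix_2(2)[OF assms] by (simp add: P)
  moreover have "aug_vec (0 :: complex^2) = 0"
    by (simp add: aug_vec_def stack_def vec_eq_iff split: sum.split)
  then have "aug_quad \<Gamma> 0 0 = 0"
    by (simp add: aug_quad_def sesq_form_def scalar_product_def)
  ultimately show ?thesis
    by (simp add: ratio_density_def ratio_density_circ_def A B hypergeom_1F1_0 power2_eq_square)
qed

theorem theorem3p1:
  fixes M :: "'a measure" and Z :: "'a \<Rightarrow> complex^2"
    and \<mu> :: "complex^2" and \<Gamma> C :: "complex^2^2"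
  assumes "prob_space M"
    and "pos_def \<Gamma>"
    and "transpose C = C"
    and "pos_def (cnj_mat \<Gamma> - conj_transpose C ** matrix_inv \<Gamma> ** C)"
    and "complex_normal M Z \<mu> \<Gamma> C"
  shows "has_complex_density1 M (\<lambda>\<omega>. Z \<omega> $ 2 / Z \<omega> $ 1) (ratio_density \<mu> \<Gamma> C)
    \<and> (C = 0 \<and> \<mu> = 0 \<longrightarrow>
         has_complex_density1 M (\<lambda>\<omega>. Z \<omega> $ 2 / Z \<omega> $ 1) (ratio_density_circ \<Gamma>)
         \<and> (\<forall>q. ratio_density \<mu> \<Gamma> C q = ratio_density_circ \<Gamma> q))"
proof -
  \<comment> \<open>By symmetry of \<open>C\<close>, the matrix assumed positive definite is exactly
    \<open>P_mat \<Gamma> C\<close>.\<close>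
  have "conj_transpose C = cnj_mat C"
    using assms(3) by (simp add: conj_transpose_def)
  then interpret admissible_2 \<Gamma> C
    using assms by unfold_locales (simp_all add: P_mat_def)
  have "has_complex_density1 M (\<lambda>\<omega>. Z \<omega> $ 2 / Z \<omega> $ 1) (ratio_density \<mu> \<Gamma> C)"
    using assms(5) ratio_density_nonneg ennreal_ratio_density
    unfolding complex_normal_def by (rule has_complex_density_ratio)
  moreover have "ratio_density 0 \<Gamma> 0 = ratio_density_circ \<Gamma>"
    using ratio_density_circ_eq[OF assms(2)] by (rule ext)
  ultimately show ?thesis by auto
qed

end
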